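(* Let $f$ be a twist map of the annulus and let $c\in\mathbb{R}$. For any discrete weak K.A.M. solution $u_c:\mathbb{R}\to\mathbb{R}$ for $f$ at cohomology class $c$, the $\alpha$-limit set of $\operatorname{Graph}(c+du_c)$ under $\Lambda_c$, $$\alpha(\operatorname{Graph}(c+du_c)):=\bigcap_{n\in\mathbb{Z}_+}\overline{\{\Lambda_c^i(x,p)\mid i\le -n,\ (x,p)\in\operatorname{Graph}(c+du_c)\}},$$ is closed, non-empty and invariant under the dynamics $F$. Furthermore, the Aubry set at cohomology class $c$ can be expressed as $$\mathcal{A}_c^*=\bigcap_{u_c}\alpha(\operatorname{Graph}(c+du_c))-(0,c),$$ where the intersection is taken over all discrete weak K.A.M. solutions $u_c$ at cohomology class $c$.
   Context: Let $\mathbb{T}=\mathbb{R}/\mathbb{Z}$. A twist map of the annulus is a $C^1$-diffeomorphism $f:\mathbb{T}\times\mathbb{R}\to\mathbb{T}\times\mathbb{R}$ such that: (1) $f$ is isotopic to the identity; (2) $f$ is exact symplectic, i.e. if $f(\theta,p)=(\theta',p')$ then the $1$-form $p'd\theta'-p\,d\theta$ is exact; (3) if $F:\mathbb{R}^2\to\mathbb{R}^2$, $F(x,p)=(y,p')$, is a lift of $f$, there is $\varepsilon>0$ with $0<\frac{\partial y}{\partial p}(x,p)<\frac1\varepsilon$ for all $(x,p)$. Fix a lift $F$ of $f$. Its generating function is a $C^2$ function $S:\mathbb{R}^2\to\mathbb{R}$ (which exists and is unique up to an additive constant) such that $S(x+1,y+1)=S(x,y)$; there is $\varepsilon>0$ with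 $\frac{\partial^2S}{\partial x\partial y}<-\varepsilon$ everywhere; and $F(x,p)=(y,p')$ if and only if $p=-\partial_1S(x,y)$ and $p'=\partial_2S(x,y)$. For $c\in\mathbb{R}$ put $S_c(x,y)=S(x,y)+c(x-y)$. For a bounded $1$-periodic $u:\mathbb{R}\to\mathbb{R}$ put $T^-[u](x)=\inf_{y\in\mathbb{R}}\{u(y)+S_c(y,x)\}$ and $T^+[u](x)=\sup_{y\in\mathbb{R}}\{u(y)-S_c(x,y)\}$. There is a unique constant $\overline{S}_c\in\mathbb{R}$ for which $u=T^-[u]-\overline{S}_c$ has a continuous $1$-periodic solution $u$; any such solution is called a discrete weak K.A.M. solution for $f$ at cohomology class $c$. For continuous $u:\mathbb{R}\to\mathbb{R}$, $\nabla^+u(x)=\{p\in\mathbb{R}:\limsup_{y\to x}\frac{u(y)-u(x)-p(y-x)}{|y-x|}\le0\}$; $\operatorname{Graph}(c+\nabla^+u_c)=\{(x,c+p):p\in\nabla^+u_c(x)\}$; $\operatorname{Graph}(c+du_c)=\{(x,c+du_c(x)):u_c\text{ differentiable at }x\}\subset\operatorname{Graph}(c+\nabla^+u_c)$. The map $\Lambda_c:\operatorname{Graph}(c+\nabla^+u_c)\to\operatorname{Graph}(c+\nabla^+u_c)$ is the well-defined map $(x,p)\mapsto(y,\partial_2S(x,y))$, where $y$ is the unique point with $T^+[u_c](x)=u_c(y)-S_c(x,y)$. It need not be invertible: for $i<0$, $\Lambda_c^i(x,p)$ denotes the full preimage of $(x,p)$ under $\Lambda_c^{|i|}$, and the set inside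 the closure is the union of all these preimages. A set $A\subset\mathbb{R}^2$ is invariant under $F$ if $F(A)=A$. Aubry set: a continuous $1$-periodic $u$ is a sub-action for $S_c$ if $u(y)-u(x)\le S_c(x,y)-\overline{S}_c$ for all $x,y\in\mathbb{R}$. The projected Aubry set $\mathcal{A}_c$ is the set of $x\in\mathbb{R}$ for which there is $y\in\mathbb{R}$ such that $u(y)-u(x)=S_c(x,y)-\overline{S}_c$ for every sub-action $u$. Every sub-action $u$ is differentiable at every point of $\mathcal{A}_c$, with derivative there independent of $u$; the Aubry set at cohomology class $c$ is $\mathcal{A}_c^*=\{(x,du(x)):x\in\mathcal{A}_c\}$. For a set $A$, $A-(0,c)$ denotes its translate. *)

theory Defs
  imports "HOL-Analysis.Analysis"
begin

section \<open>Differentiability classes\<close>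

definition C1_map :: "('a::real_normed_vector \<Rightarrow> 'b::real_normed_vector) \<Rightarrow> bool" where
  "C1_map g \<longleftrightarrow> (\<exists>g' :: 'a \<Rightarrow> 'a \<Rightarrow>\<^sub>L 'b.
     (\<forall>z. (g has_derivative blinfun_apply (g' z)) (at z)) \<and> continuous_on UNIV g')"

definition C2_map :: "('a::real_normed_vector \<Rightarrow> 'b::real_normed_vector) \<Rightarrow> bool" where
  "C2_map g \<longleftrightarrow> (\<exists>g' :: 'a \<Rightarrow> 'a \<Rightarrow>\<^sub>L 'b.
     (\<forall>z. (g has_derivative blinfun_apply (g' z)) (at z)) \<and> C1_map g')"

abbreviation d1 :: "(real \<times> real \<Rightarrow> real) \<Rightarrow> real \<Rightarrow> real \<Rightarrow> real" where
  "d1 S x y \<equiv> deriv (\<lambda>t. S (t, y)) x"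

abbreviation d2 :: "(real \<times> real \<Rightarrow> real) \<Rightarrow> real \<Rightarrow> real \<Rightarrow> real" where
  "d2 S x y \<equiv> deriv (\<lambda>t. S (x, t)) y"

definition periodic1 :: "(real \<Rightarrow> real) \<Rightarrow> bool" where
  "periodic1 u \<longleftrightarrow> (\<forall>x. u (x + 1) = u x)"

section \<open>Twist maps of the annulus\<close>

text \<open>The circle of reals modulo integers is realised as the unit circle of the complex plane, via
  the class of \<open>x\<close> mapping to \<open>cis (2 * pi * x)\<close>; \<open>annulus_proj\<close> is then the universal covering
  of the annulus by the plane. Maps of the annulus are total functions that only matter on
  \<open>annulus\<close>.\<close>

definition annulus :: "(complex \<times> real) set" where
  "annulus = sphere 0 1 \<times> UNIV"

definition annulus_proj :: "real \<times> real \<Rightarrow> complex \<times> real" where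
  "annulus_proj = (\<lambda>(x, p). (cis (2 * pi * x), p))"

text \<open>Since \<open>annulus_proj\<close> is a local diffeomorphism onto the embedded submanifold \<open>annulus\<close>, a map
  \<open>g\<close> of the annulus to itself is of class C1 if and only if \<open>g \<circ> annulus_proj\<close> is.\<close>

definition annulus_C1_diffeo :: "(complex \<times> real \<Rightarrow> complex \<times> real) \<Rightarrow> bool" where
  "annulus_C1_diffeo f \<longleftrightarrow> bij_betw f annulus annulus \<and>
     C1_map (f \<circ> annulus_proj) \<and> C1_map (inv_into annulus f \<circ> annulus_proj)"

definition isotopic_to_identity :: "(complex \<times> real \<Rightarrow> complex \<times> real) \<Rightarrow> bool" where
  "isotopic_to_identity f \<longleftrightarrow>
     homotopic_with_canon (homeomorphic_map (top_of_set annulus) (top_of_set annulus))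
       annulus annulus id f"

definition is_lift :: "(real \<times> real \<Rightarrow> real \<times> real) \<Rightarrow> (complex \<times> real \<Rightarrow> complex \<times> real) \<Rightarrow> bool" where
  "is_lift F f \<longleftrightarrow> continuous_on UNIV F \<and> (\<forall>z. annulus_proj (F z) = f (annulus_proj z))"

text \<open>The primitive \<open>h\<close> lives on the annulus. On the covering, with \<open>F (x, p) = (y, p')\<close>, the
  condition reads \<open>d (h \<circ> annulus_proj) = p' dy - p dx\<close>; it does not depend on the lift, as two
  lifts differ by a constant.\<close>

definition exact_symplectic :: "(complex \<times> real \<Rightarrow> complex \<times> real) \<Rightarrow> bool" where
  "exact_symplectic f \<longleftrightarrow> (\<forall>F. is_lift F f \<longrightarrow>
     (\<exists>h :: complex \<times> real \<Rightarrow> real. \<forall>z.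
        ((h \<circ> annulus_proj) has_derivative
           (\<lambda>v. snd (F z) * fst (frechet_derivative F (at z) v) - snd z * fst v)) (at z)))"

definition twist_map :: "(complex \<times> real \<Rightarrow> complex \<times> real) \<Rightarrow> bool" where
  "twist_map f \<longleftrightarrow> annulus_C1_diffeo f \<and> isotopic_to_identity f \<and> exact_symplectic f \<and>
     (\<forall>F. is_lift F f \<longrightarrow> (\<exists>\<epsilon>>0. \<forall>x p.
        0 < deriv (\<lambda>t. fst (F (x, t))) p \<and> deriv (\<lambda>t. fst (F (x, t))) p < 1 / \<epsilon>))"

definition generating_function ::
    "(real \<times> real \<Rightarrow> real) \<Rightarrow> (real \<times> real \<Rightarrow> real \<times> real) \<Rightarrow> bool" where
  "generating_function S F \<longleftrightarrow> C2_map S \<and>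
     (\<forall>x y. S (x + 1, y + 1) = S (x, y)) \<and>
     (\<exists>\<epsilon>>0. \<forall>x y. deriv (\<lambda>t. d2 S t y) x < - \<epsilon>) \<and>
     (\<forall>x p y p'. F (x, p) = (y, p') \<longleftrightarrow> p = - d1 S x y \<and> p' = d2 S x y)"

section \<open>Discrete weak KAM solutions\<close>

definition S_coh :: "(real \<times> real \<Rightarrow> real) \<Rightarrow> real \<Rightarrow> real \<times> real \<Rightarrow> real" where
  "S_coh S c = (\<lambda>(x, y). S (x, y) + c * (x - y))"

definition T_minus :: "(real \<times> real \<Rightarrow> real) \<Rightarrow> real \<Rightarrow> (real \<Rightarrow> real) \<Rightarrow> real \<Rightarrow> real" where
  "T_minus S c u x = (INF y. u y + S_coh S c (y, x))"

definition T_plus :: "(real \<times> real \<Rightarrow> real) \<Rightarrow> real \<Rightarrow> (real \<Rightarrow> real) \<Rightarrow> real \<Rightarrow> real" where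
  "T_plus S c u x = (SUP y. u y - S_coh S c (x, y))"

definition S_bar :: "(real \<times> real \<Rightarrow> real) \<Rightarrow> real \<Rightarrow> real" where
  "S_bar S c = (THE s. \<exists>u. continuous_on UNIV u \<and> periodic1 u \<and> (\<forall>x. u x = T_minus S c u x - s))"

definition weak_KAM :: "(real \<times> real \<Rightarrow> real) \<Rightarrow> real \<Rightarrow> (real \<Rightarrow> real) \<Rightarrow> bool" where
  "weak_KAM S c u \<longleftrightarrow> continuous_on UNIV u \<and> periodic1 u \<and> (\<forall>x. u x = T_minus S c u x - S_bar S c)"

definition superdiff :: "(real \<Rightarrow> real) \<Rightarrow> real \<Rightarrow> real set" where
  "superdiff u x =
     {p. Limsup (at x) (\<lambda>y. ereal ((u y - u x - p * (y - x)) / \<bar>y - x\<bar>)) \<le> 0}"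

definition graph_superdiff :: "real \<Rightarrow> (real \<Rightarrow> real) \<Rightarrow> (real \<times> real) set" where
  "graph_superdiff c u = {(x, c + p) | x p. p \<in> superdiff u x}"

definition graph_deriv :: "real \<Rightarrow> (real \<Rightarrow> real) \<Rightarrow> (real \<times> real) set" where
  "graph_deriv c u = {(x, c + deriv u x) | x. u differentiable (at x)}"

text \<open>\<open>Lambda\<close> is meaningful on \<open>graph_superdiff c u\<close>, for \<open>u\<close> a weak KAM solution.\<close>

definition Lambda ::
    "(real \<times> real \<Rightarrow> real) \<Rightarrow> real \<Rightarrow> (real \<Rightarrow> real) \<Rightarrow> real \<times> real \<Rightarrow> real \<times> real" where
  "Lambda S c u = (\<lambda>(x, p).
     let y = (THE y. T_plus S c u x = u y - S_coh S c (x, y)) in (y, d2 S x y))"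

text \<open>\<open>Lambda_preimage S c u m z\<close> is the full preimage of \<open>z\<close> under the \<open>m\<close>-th iterate of the map
  \<open>Lambda S c u\<close> of \<open>graph_superdiff c u\<close>, i.e. its iterate of exponent \<open>- m\<close> at \<open>z\<close>.\<close>

definition Lambda_preimage ::
    "(real \<times> real \<Rightarrow> real) \<Rightarrow> real \<Rightarrow> (real \<Rightarrow> real) \<Rightarrow> nat \<Rightarrow> real \<times> real \<Rightarrow> (real \<times> real) set" where
  "Lambda_preimage S c u m z = {w \<in> graph_superdiff c u. (Lambda S c u ^^ m) w = z}"

definition alpha_limit ::
    "(real \<times> real \<Rightarrow> real) \<Rightarrow> real \<Rightarrow> (real \<Rightarrow> real) \<Rightarrow> (real \<times> real) set" where
  "alpha_limit S c u =
     (\<Inter>n::nat. closure (\<Union>m\<in>{n..}. \<Union>z\<in>graph_deriv c u. Lambda_preimage S c u m z))"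

section \<open>The Aubry set\<close>

definition sub_action :: "(real \<times> real \<Rightarrow> real) \<Rightarrow> real \<Rightarrow> (real \<Rightarrow> real) \<Rightarrow> bool" where
  "sub_action S c u \<longleftrightarrow> continuous_on UNIV u \<and> periodic1 u \<and>
     (\<forall>x y. u y - u x \<le> S_coh S c (x, y) - S_bar S c)"

definition proj_Aubry_set :: "(real \<times> real \<Rightarrow> real) \<Rightarrow> real \<Rightarrow> real set" where
  "proj_Aubry_set S c =
     {x. \<exists>y. \<forall>u. sub_action S c u \<longrightarrow> u y - u x = S_coh S c (x, y) - S_bar S c}"

text \<open>All sub-actions have the same derivative at each point of \<open>proj_Aubry_set S c\<close>, so any of them
  may be used.\<close>

definition Aubry_set :: "(real \<times> real \<Rightarrow> real) \<Rightarrow> real \<Rightarrow> (real \<times> real) set" where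
  "Aubry_set S c = {(x, p) | x p. x \<in> proj_Aubry_set S c \<and>
     (\<exists>u. sub_action S c u \<and> (u has_real_derivative p) (at x))}"

end

theory Submission
  imports Defs
begin

text \<open>
For a discrete weak KAM solution \<open>u\<close>, write \<open>L (x, y) = S_c (x, y)\<close> for the cost and call a pair
\<open>(x, y)\<close> calibrated by \<open>u\<close> if \<open>u y - u x\<close> has its largest possible value, the cost of the pair minus the
constant \<open>S_bar\<close>. The weak KAM equation says that every point has a calibrated source. A source
provides a smooth function that touches \<open>u\<close> from above, a target one that touches it from below
(\<open>calibrated_on_both_sides\<close>). So \<open>u\<close> is differentiable at the source of any point, and there the
dynamics \<open>F\<close> follows the calibrated pairs. Therefore the inverse of \<open>F\<close> maps the graph \<open>G\<close> of
\<open>c + du\<close> into itself, and \<open>Lambda\<close>, which is \<open>F\<close> on the points concerned, has only the corresponding point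
of the \<open>F\<close>-orbit as a preimage of a point of \<open>G\<close> (\<open>Lambda_preimage_eq\<close>). Consequently the
\<open>\<alpha>\<close>-limit set is the intersection of the closures of the decreasing sets \<open>(F ^^ n) -` G\<close>. As \<open>F\<close> is a
homeomorphism of the plane it is invariant, and compactness modulo integer translations shows that it
is nonempty.

For the Aubry set, let \<open>Q\<close> consist of the points \<open>(x, - d1 S x y)\<close> for which \<open>(x, y)\<close> is calibrated by all
sub-actions; it is the Aubry set translated by \<open>(0, c)\<close>. Applying the definition of \<open>Q\<close> to forward
Lax--Oleinik transforms of sub-actions shows that \<open>F\<close> maps \<open>Q\<close> into itself, and \<open>Q\<close> is contained in the
graph of each weak KAM solution; so \<open>Q\<close> is contained in each \<open>\<alpha>\<close>-limit set. The other inclusion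
rests on \<open>sub_action_below_weak_solution\<close>. Starting from any sub-action \<open>v\<close>, the
normalized Lax--Oleinik iterates of \<open>v\<close> increase uniformly to a weak KAM solution \<open>u\<close>, and \<open>u = v\<close> along
every infinite forward orbit that is calibrated by \<open>u\<close>. Orbits in the \<open>\<alpha>\<close>-limit set of \<open>u\<close> are of
this kind, so a point that belongs to the \<open>\<alpha>\<close>-limit sets of all solutions begins with a pair
calibrated by every \<open>v\<close>.

The existence of weak KAM solutions and the uniqueness of the constant, without which \<open>S_bar\<close> would be
meaningless, are established for general continuous coercive costs that are periodic along the
diagonal. The images of the Lax--Oleinik operator are equicontinuous with a common modulus, so its
iterates drift at a constant rate up to a bounded error, and the lower limit of the iterates
without the drift is a solution (\<open>weak_solution_exists\<close>).
\<close>

section \<open>Continuous functions that are periodic along the diagonal\<close>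

lemma periodic1_add_int:
  assumes "periodic1 u"
  shows "u (x + of_int k) = u x"
proof (induction k rule: int_induct[where k = 0])
  case base
  then show ?case by simp
next
  case (step1 i)
  have "u (x + of_int (i + 1)) = u (x + of_int i + 1)" by (simp add: add.assoc)
  then show ?case using step1 assms by (simp add: periodic1_def)
next
  case (step2 i)
  have "u (x + of_int i) = u (x + of_int (i - 1) + 1)" by simp
  then show ?case using step2 assms unfolding periodic1_def by metis
qed

lemma diagonal_periodic_add_int:
  fixes g :: "real \<Rightarrow> real \<Rightarrow> 'a"
  assumes "\<And>x y. g (x + 1) (y + 1) = g x y"
  shows "g (x + of_int k) (y + of_int k) = g x y"
proof (induction k rule: int_induct[where k = 0])
  case base
  then show ?case by simp
next
  case (step1 i)
  then show ?case using assms[of "x + of_int i" "y + of_int i"] by (simp add: add.assoc)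
next
  case (step2 i)
  then show ?case using assms[of "x + of_int (i - 1)" "y + of_int (i - 1)"]
    by (simp add: algebra_simps)
qed

lemma int_translate_near:
  fixes x y :: real
  obtains k :: int where "0 \<le> x + of_int k - y" "x + of_int k - y \<le> 1"
proof
  show "0 \<le> x + of_int (- \<lfloor>x - y\<rfloor>) - y" "x + of_int (- \<lfloor>x - y\<rfloor>) - y \<le> 1"
    by linarith+
qed

text \<open>A diagonal strip is covered by the integer translates of a compact rectangle, so a continuous
function that is invariant under these translations behaves on the strip as on a compact set.\<close>

lemma diagonal_periodic_bounded_on_strip:
  fixes g :: "real \<Rightarrow> real \<Rightarrow> real"
  assumes cont: "continuous_on UNIV (\<lambda>z. g (fst z) (snd z))"
    and per: "\<And>x y. g (x + 1) (y + 1) = g x y"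
  obtains B where "\<And>x y. \<bar>x - y\<bar> \<le> r \<Longrightarrow> \<bar>g x y\<bar> \<le> B"
proof -
  have "compact ((\<lambda>z. g (fst z) (snd z)) ` ({0..1} \<times> {- \<bar>r\<bar>..1 + \<bar>r\<bar>}))"
    by (intro compact_continuous_image compact_Times continuous_on_subset[OF cont]) auto
  then obtain B where B: "\<And>z. z \<in> {0..1} \<times> {- \<bar>r\<bar>..1 + \<bar>r\<bar>} \<Longrightarrow> \<bar>g (fst z) (snd z)\<bar> \<le> B"
    by (force dest!: compact_imp_bounded simp: bounded_iff)
  show ?thesis
  proof
    fix x y :: real assume xy: "\<bar>x - y\<bar> \<le> r"
    obtain k :: int where k: "0 \<le> x + of_int k - 0" "x + of_int k - 0 \<le> 1"
      by (rule int_translate_near)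
    have "\<bar>g (x + of_int k) (y + of_int k)\<bar> \<le> B"
      using B[of "(x + of_int k, y + of_int k)"] k xy by (auto simp: abs_le_iff)
    then show "\<bar>g x y\<bar> \<le> B"
      by (simp add: diagonal_periodic_add_int[of g, OF per])
  qed
qed

text \<open>The compact rectangle extends one unit further at both ends, to contain the perturbed second coordinate
as well.\<close>

lemma diagonal_periodic_uniformly_continuous_on_strip:
  fixes g :: "real \<Rightarrow> real \<Rightarrow> real"
  assumes cont: "continuous_on UNIV (\<lambda>z. g (fst z) (snd z))"
    and per: "\<And>x y. g (x + 1) (y + 1) = g x y"
    and "0 < e"
  obtains d where "0 < d"
    "\<And>x y y'. \<bar>x - y\<bar> \<le> r \<Longrightarrow> \<bar>y' - y\<bar> < d \<Longrightarrow> \<bar>g x y' - g x y\<bar> < e"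
proof -
  let ?K = "{0..1} \<times> {- \<bar>r\<bar> - 1..2 + \<bar>r\<bar>} :: (real \<times> real) set"
  have "uniformly_continuous_on ?K (\<lambda>z. g (fst z) (snd z))"
    by (intro compact_uniformly_continuous compact_Times continuous_on_subset[OF cont]) auto
  then obtain d where d: "d > 0"
    "\<And>z z'. z \<in> ?K \<Longrightarrow> z' \<in> ?K \<Longrightarrow> dist z' z < d
       \<Longrightarrow> dist (g (fst z') (snd z')) (g (fst z) (snd z)) < e"
    using \<open>0 < e\<close> unfolding uniformly_continuous_on_def by metis
  show ?thesis
  proof
    show "0 < min d 1" using d by simp
    fix x y y' :: real assume xy: "\<bar>x - y\<bar> \<le> r" "\<bar>y' - y\<bar> < min d 1"
    obtain k :: int where k: "0 \<le> x + of_int k - 0" "x + of_int k - 0 \<le> 1"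
      by (rule int_translate_near)
    have "dist (g (x + of_int k) (y' + of_int k)) (g (x + of_int k) (y + of_int k)) < e"
      using d(2)[of "(x + of_int k, y + of_int k)" "(x + of_int k, y' + of_int k)"] k xy
      by (simp add: dist_Pair_Pair dist_real_def) linarith
    then show "\<bar>g x y' - g x y\<bar> < e"
      by (simp add: diagonal_periodic_add_int[of g, OF per] dist_real_def)
  qed
qed

text \<open>The Lax--Oleinik operator is applied below to lower limits of functions whose continuity is known
only afterwards, so boundedness replaces continuity in the domain of the operator.\<close>

definition bounded_periodic :: "(real \<Rightarrow> real) \<Rightarrow> bool" where
  "bounded_periodic u \<longleftrightarrow> periodic1 u \<and> bounded (range u)"

lemma continuous_periodic_imp_bounded_periodic:
  assumes "continuous_on UNIV u" "periodic1 u"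
  shows "bounded_periodic u"
proof -
  have "u ` {0..1} = range u"
  proof (intro equalityI subsetI)
    fix t assume "t \<in> range u"
    then obtain x where x: "t = u x" by auto
    obtain k :: int where "0 \<le> x + of_int k - 0" "x + of_int k - 0 \<le> 1"
      by (rule int_translate_near)
    then show "t \<in> u ` {0..1}"
      using periodic1_add_int[OF assms(2), of x k] x by (intro image_eqI[of _ _ "x + of_int k"]) auto
  qed auto
  moreover have "compact (u ` {0..1})"
    by (intro compact_continuous_image continuous_on_subset[OF assms(1)]) auto
  ultimately show ?thesis
    using assms(2) compact_imp_bounded unfolding bounded_periodic_def by metis
qed

section \<open>The Lax--Oleinik operator of a coercive periodic cost\<close>

text \<open>Superlinear growth enters only through the constant \<open>R\<close>: a pair at distance more than \<open>R\<close> costs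
more than every pair at distance at most \<open>1\<close>. A far away source can thus be replaced by one of its
integer translates near the target, which decreases the cost and leaves the value of a periodic
function unchanged. All the minimizations below take place in the strip of width \<open>R\<close> for this reason,
with bounds that do not depend on the function.\<close>

locale periodic_cost =
  fixes L :: "real \<Rightarrow> real \<Rightarrow> real" and R :: real
  assumes cost_continuous: "continuous_on UNIV (\<lambda>z. L (fst z) (snd z))"
    and cost_shift: "L (x + 1) (y + 1) = L x y"
    and R_ge_1: "1 \<le> R"
    and cost_coercive: "R < \<bar>x - y\<bar> \<Longrightarrow> \<bar>x' - y'\<bar> \<le> 1 \<Longrightarrow> L x' y' < L x y"
begin

definition lax_oleinik :: "(real \<Rightarrow> real) \<Rightarrow> real \<Rightarrow> real" where
  "lax_oleinik u x = (INF y. u y + L y x)"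

text \<open>Exchanging source and target turns the backward operator into the forward one, up to sign: the
supremum of \<open>u y - L x y\<close> over \<open>y\<close> is minus the Lax--Oleinik operator of the swapped cost applied
to \<open>- u\<close>. Statements on forward maximizers follow from those on backward minimizers.\<close>

lemma swapped_periodic_cost: "periodic_cost (\<lambda>x y. L y x) R"
proof
  have "continuous_on UNIV ((\<lambda>z. L (fst z) (snd z)) \<circ> prod.swap)"
    by (intro continuous_on_compose continuous_on_swap continuous_on_subset[OF cost_continuous]) auto
  then show "continuous_on UNIV (\<lambda>z. L (snd z) (fst z))" by (simp add: o_def)
  show "L y' x' < L y x" if "R < \<bar>x - y\<bar>" "\<bar>x' - y'\<bar> \<le> 1" for x y x' y'
    using cost_coercive[of y x y' x'] that by (simp add: abs_minus_commute)
qed (use cost_shift R_ge_1 in auto)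

lemma cost_bounded_below: obtains m where "\<And>x y. m \<le> L x y"
proof -
  obtain B where B: "\<And>x y. \<bar>x - y\<bar> \<le> R \<Longrightarrow> \<bar>L x y\<bar> \<le> B"
    using diagonal_periodic_bounded_on_strip[of L R, OF cost_continuous cost_shift] by blast
  show ?thesis
  proof
    show "- B \<le> L x y" for x y
      using B[of x y] cost_coercive[of x y x x] B[of x x] R_ge_1 by (cases "\<bar>x - y\<bar> \<le> R") auto
  qed
qed

lemma move_source_near:
  obtains k :: int where "\<bar>y + of_int k - x\<bar> \<le> R" "L (y + of_int k) x \<le> L y x"
proof (cases "\<bar>y - x\<bar> \<le> R")
  case True
  then show ?thesis using that[of 0] by simp
next
  case False
  obtain k :: int where "0 \<le> y + of_int k - x" "y + of_int k - x \<le> 1"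
    by (rule int_translate_near)
  then show ?thesis using that[of k] R_ge_1 cost_coercive[of y x "y + of_int k" x] False by simp
qed

lemma lax_oleinik_bdd_below:
  assumes "bounded_periodic u"
  shows "bdd_below (range (\<lambda>y. u y + L y x))"
proof -
  obtain B where B: "\<And>y. \<bar>u y\<bar> \<le> B"
    using assms unfolding bounded_periodic_def bounded_iff by auto
  obtain m where m: "\<And>x y. m \<le> L x y" by (rule cost_bounded_below) blast
  have "m - B \<le> u y + L y x" for y
    using B[of y] m[of y x] by linarith
  then show ?thesis by (intro bdd_belowI[of _ "m - B"]) auto
qed

lemma lax_oleinik_le:
  assumes "bounded_periodic u"
  shows "lax_oleinik u x \<le> u y + L y x"
  unfolding lax_oleinik_def by (rule cINF_lower[OF lax_oleinik_bdd_below[OF assms]]) simp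

text \<open>Lower bounds need only be checked for sources at distance at most \<open>R\<close>, since every source has an
integer translate that is near and cheaper.\<close>

lemma lax_oleinik_greatest:
  assumes "periodic1 u" "\<And>y. \<bar>y - x\<bar> \<le> R \<Longrightarrow> a \<le> u y + L y x"
  shows "a \<le> lax_oleinik u x"
  unfolding lax_oleinik_def
proof (rule cINF_greatest)
  fix y
  obtain k :: int where "\<bar>y + of_int k - x\<bar> \<le> R" "L (y + of_int k) x \<le> L y x"
    by (rule move_source_near)
  then show "a \<le> u y + L y x"
    using assms(2)[of "y + of_int k"] periodic1_add_int[OF assms(1), of y k] by simp
qed simp

text \<open>With \<open>a = 0\<close> this is monotonicity; applied in both directions it says that the operator does not
expand the supremum distance.\<close>

lemma lax_oleinik_mono:
  assumes "bounded_periodic u" "bounded_periodic v" "\<And>x. u x \<le> v x + a"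
  shows "lax_oleinik u x \<le> lax_oleinik v x + a"
proof -
  have "lax_oleinik u x - a \<le> lax_oleinik v x"
  proof (rule lax_oleinik_greatest)
    show "periodic1 v" using assms by (simp add: bounded_periodic_def)
    fix y show "lax_oleinik u x - a \<le> v y + L y x"
      using lax_oleinik_le[OF assms(1), of x y] assms(3)[of y] by simp
  qed
  then show ?thesis by simp
qed

lemma lax_oleinik_add_const:
  assumes "bounded_periodic u" "bounded_periodic (\<lambda>x. u x + a)"
  shows "lax_oleinik (\<lambda>x. u x + a) x = lax_oleinik u x + a"
proof (rule antisym)
  show "lax_oleinik (\<lambda>x. u x + a) x \<le> lax_oleinik u x + a"
    by (rule lax_oleinik_mono) (use assms in auto)
  have "lax_oleinik u x \<le> lax_oleinik (\<lambda>x. u x + a) x + (- a)"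
    by (rule lax_oleinik_mono) (use assms in auto)
  then show "lax_oleinik u x + a \<le> lax_oleinik (\<lambda>x. u x + a) x" by simp
qed

lemma lax_oleinik_periodic:
  assumes "bounded_periodic u"
  shows "periodic1 (lax_oleinik u)"
  unfolding periodic1_def
proof (rule allI, rule antisym)
  have per: "periodic1 u" using assms by (simp add: bounded_periodic_def)
  fix x
  show "lax_oleinik u (x + 1) \<le> lax_oleinik u x"
  proof (rule lax_oleinik_greatest[OF per])
    fix y show "lax_oleinik u (x + 1) \<le> u y + L y x"
      using lax_oleinik_le[OF assms, of "x + 1" "y + 1"] per cost_shift
      by (simp add: periodic1_def)
  qed
  show "lax_oleinik u x \<le> lax_oleinik u (x + 1)"
  proof (rule lax_oleinik_greatest[OF per])
    fix y show "lax_oleinik u x \<le> u y + L y (x + 1)"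
      using lax_oleinik_le[OF assms, of x "y - 1"] per[unfolded periodic1_def, rule_format, of "y - 1"]
        cost_shift[of "y - 1" x]
      by simp
  qed
qed

text \<open>The modulus of continuity is that of the cost on the strip of width \<open>R\<close>, hence the same for all
functions \<open>u\<close>, however rough or large.\<close>

lemma lax_oleinik_equicontinuous:
  assumes "0 < e"
  obtains d where "0 < d"
    "\<And>u x x'. bounded_periodic u \<Longrightarrow> \<bar>x - x'\<bar> < d \<Longrightarrow> \<bar>lax_oleinik u x - lax_oleinik u x'\<bar> \<le> e"
proof -
  obtain d where d: "0 < d"
    "\<And>y x x'. \<bar>y - x\<bar> \<le> R \<Longrightarrow> \<bar>x' - x\<bar> < d \<Longrightarrow> \<bar>L y x' - L y x\<bar> < e"
    using diagonal_periodic_uniformly_continuous_on_strip[of L e R, OF cost_continuous cost_shift assms]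
    by blast
  have *: "lax_oleinik u x' - e \<le> lax_oleinik u x"
    if "bounded_periodic u" "\<bar>x' - x\<bar> < d" for u x x'
  proof (rule lax_oleinik_greatest)
    show "periodic1 u" using that by (simp add: bounded_periodic_def)
    fix y assume "\<bar>y - x\<bar> \<le> R"
    then show "lax_oleinik u x' - e \<le> u y + L y x"
      using lax_oleinik_le[OF that(1), of x' y] d(2)[of y x x'] that by simp
  qed
  show ?thesis
  proof
    show "0 < d" by fact
    fix u x x' assume "bounded_periodic u" "\<bar>x - x'\<bar> < d"
    then show "\<bar>lax_oleinik u x - lax_oleinik u x'\<bar> \<le> e"
      using *[of u x x'] *[of u x' x] by (simp add: abs_minus_commute)
  qed
qed

text \<open>Any point has an integer translate at distance at most \<open>1\<close> from any other one, so the oscillation is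
bounded by the variation of the cost on a strip.\<close>

lemma lax_oleinik_oscillation:
  obtains K where "0 \<le> K"
    "\<And>u x x'. bounded_periodic u \<Longrightarrow> lax_oleinik u x \<le> lax_oleinik u x' + K"
proof -
  obtain B where B: "\<And>x y. \<bar>x - y\<bar> \<le> R + 1 \<Longrightarrow> \<bar>L x y\<bar> \<le> B"
    using diagonal_periodic_bounded_on_strip[of L "R + 1", OF cost_continuous cost_shift] by blast
  show ?thesis
  proof
    show "0 \<le> 2 * B" using B[of 0 0] R_ge_1 by simp
    fix u and x x' :: real assume u: "bounded_periodic u"
    obtain k :: int where k: "0 \<le> x + of_int k - x'" "x + of_int k - x' \<le> 1"
      by (rule int_translate_near[of x x'])
    have "lax_oleinik u (x + of_int k) - 2 * B \<le> lax_oleinik u x'"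
    proof (rule lax_oleinik_greatest)
      show "periodic1 u" using u by (simp add: bounded_periodic_def)
      fix y assume "\<bar>y - x'\<bar> \<le> R"
      then show "lax_oleinik u (x + of_int k) - 2 * B \<le> u y + L y x'"
        using lax_oleinik_le[OF u, of "x + of_int k" y] B[of y "x + of_int k"] B[of y x'] k
        by (simp add: abs_le_iff)
    qed
    then show "lax_oleinik u x \<le> lax_oleinik u x' + 2 * B"
      using periodic1_add_int[OF lax_oleinik_periodic[OF u], of x k] by simp
  qed
qed

lemma lax_oleinik_continuous:
  assumes "bounded_periodic u"
  shows "continuous_on UNIV (lax_oleinik u)"
  unfolding continuous_on_iff
proof (intro ballI allI impI)
  fix x e :: real assume "0 < e"
  then have "0 < e / 2" by simp
  then obtain d where "0 < d"
    "\<And>u x x'. bounded_periodic u \<Longrightarrow> \<bar>x - x'\<bar> < d \<Longrightarrow> \<bar>lax_oleinik u x - lax_oleinik u x'\<bar> \<le> e / 2"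
    by (rule lax_oleinik_equicontinuous) blast
  then show "\<exists>d>0. \<forall>x'\<in>UNIV. dist x' x < d \<longrightarrow> dist (lax_oleinik u x') (lax_oleinik u x) < e"
    using \<open>0 < e\<close> assms by (intro exI[of _ d]) (fastforce simp: dist_real_def)
qed

lemma lax_oleinik_bounded_periodic:
  "bounded_periodic u \<Longrightarrow> bounded_periodic (lax_oleinik u)"
  using continuous_periodic_imp_bounded_periodic lax_oleinik_continuous lax_oleinik_periodic by blast

lemma lax_oleinik_attained:
  assumes "continuous_on UNIV u" "periodic1 u"
  obtains y where "\<bar>y - x\<bar> \<le> R" "lax_oleinik u x = u y + L y x"
proof -
  have "continuous_on UNIV ((\<lambda>z. L (fst z) (snd z)) \<circ> (\<lambda>y. (y, x)))"
    by (intro continuous_on_compose continuous_intros continuous_on_subset[OF cost_continuous]) auto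
  then have "continuous_on {x - R..x + R} (\<lambda>y. u y + L y x)"
    by (intro continuous_intros continuous_on_subset[OF assms(1)])
       (auto simp: o_def intro: continuous_on_subset)
  then obtain y where y: "y \<in> {x - R..x + R}" "\<And>y'. y' \<in> {x - R..x + R} \<Longrightarrow> u y + L y x \<le> u y' + L y' x"
    using continuous_attains_inf[of "{x - R..x + R}" "\<lambda>y. u y + L y x"] R_ge_1 by auto
  show ?thesis
  proof
    show "\<bar>y - x\<bar> \<le> R" using y by (auto simp: abs_le_iff)
    show "lax_oleinik u x = u y + L y x"
    proof (rule antisym)
      show "lax_oleinik u x \<le> u y + L y x"
        by (intro lax_oleinik_le continuous_periodic_imp_bounded_periodic assms)
      show "u y + L y x \<le> lax_oleinik u x"
        by (rule lax_oleinik_greatest[OF assms(2)]) (use y in \<open>auto simp: abs_le_iff\<close>)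
    qed
  qed
qed

section \<open>Weak solutions and sub-actions\<close>

text \<open>The additive constant \<open>s\<close> is a parameter here, because the constant \<open>S_bar\<close> is a definite description
that has a meaning only once existence and uniqueness are known.\<close>

definition weak_solution :: "real \<Rightarrow> (real \<Rightarrow> real) \<Rightarrow> bool" where
  "weak_solution s u \<longleftrightarrow> continuous_on UNIV u \<and> periodic1 u \<and> (\<forall>x. u x = lax_oleinik u x - s)"

lemma weak_solution_bounded_periodic: "weak_solution s u \<Longrightarrow> bounded_periodic u"
  unfolding weak_solution_def by (blast intro: continuous_periodic_imp_bounded_periodic)

text \<open>From its second term on, the sequence has the modulus of continuity common to all images of the
operator, so its pointwise supremum is continuous. As in Dini's theorem, compactness of a period and
monotonicity make the convergence uniform, and the operator is continuous for uniform convergence.\<close>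

lemma increasing_iterates_converge:
  assumes bp: "\<And>n. bounded_periodic (v n)"
    and step: "\<And>n x. v (Suc n) x = lax_oleinik (v n) x - s"
    and inc: "\<And>n x. v n x \<le> v (Suc n) x"
    and bdd: "\<And>n x. v n x \<le> B"
  obtains u where "weak_solution s u" "\<And>n x. v n x \<le> u x"
    "\<And>e. 0 < e \<Longrightarrow> \<exists>n. \<forall>x. u x \<le> v n x + e"
proof -
  define u where "u x = (SUP n. v n x)" for x
  have bdd': "bdd_above (range (\<lambda>n. v n x))" for x
    using bdd by (intro bdd_aboveI[of _ B]) auto
  have incr: "incseq (\<lambda>n. v n x)" for x
    using inc by (simp add: incseq_SucI)
  have lim: "(\<lambda>n. v n x) \<longlonglongrightarrow> u x" for x
    unfolding u_def by (rule LIMSEQ_incseq_SUP[OF bdd' incr])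
  have le: "v n x \<le> u x" for n x
    unfolding u_def by (rule cSUP_upper[OF _ bdd']) simp
  have per: "periodic1 u"
    using bp by (simp add: periodic1_def u_def bounded_periodic_def)
  have cont: "continuous_on UNIV u"
    unfolding continuous_on_iff
  proof (intro ballI allI impI)
    fix x e :: real assume "0 < e"
    then have "0 < e / 2" by simp
    then obtain d where d: "0 < d"
      "\<And>u x x'. bounded_periodic u \<Longrightarrow> \<bar>x - x'\<bar> < d \<Longrightarrow> \<bar>lax_oleinik u x - lax_oleinik u x'\<bar> \<le> e / 2"
      by (rule lax_oleinik_equicontinuous) blast
    have "\<bar>u x' - u x\<bar> \<le> e / 2" if "\<bar>x' - x\<bar> < d" for x'
    proof (rule LIMSEQ_le_const2)
      show "(\<lambda>n. \<bar>v (Suc n) x' - v (Suc n) x\<bar>) \<longlonglongrightarrow> \<bar>u x' - u x\<bar>"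
        by (intro tendsto_intros LIMSEQ_Suc lim)
      show "\<exists>N. \<forall>n\<ge>N. \<bar>v (Suc n) x' - v (Suc n) x\<bar> \<le> e / 2"
        using d(2)[OF bp that] step by simp
    qed
    then show "\<exists>d>0. \<forall>x'\<in>UNIV. dist x' x < d \<longrightarrow> dist (u x') (u x) < e"
      using d(1) \<open>0 < e\<close> by (intro exI[of _ d]) (fastforce simp: dist_real_def)
  qed
  have vcont: "continuous_on UNIV (v (Suc n))" for n
  proof -
    have "v (Suc n) = (\<lambda>x. lax_oleinik (v n) x - s)" by (rule ext) (rule step)
    then show ?thesis
      using continuous_on_diff[OF lax_oleinik_continuous[OF bp] continuous_on_const] by metis
  qed
  \<comment> \<open>if uniformity failed, the points where it fails would accumulate, and monotonicity would carry the gap to the accumulation point for every index\<close>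
  have unif: "\<exists>n. \<forall>x. u x \<le> v n x + e" if "0 < e" for e
  proof (rule ccontr)
    assume "\<not> ?thesis"
    then have "\<forall>n. \<exists>x. v n x + e < u x" by (simp add: not_le)
    then obtain y where y: "\<And>n. v n (y n) + e < u (y n)" by metis
    have "\<exists>x\<in>{0..1}. v n x + e < u x" for n
    proof -
      obtain k :: int where k: "0 \<le> y n + of_int k - 0" "y n + of_int k - 0 \<le> 1"
        by (rule int_translate_near)
      show ?thesis
        using k y[of n] periodic1_add_int[OF per, of "y n" k]
          periodic1_add_int[of "v n" "y n" k] bp[of n]
        by (intro bexI[of _ "y n + of_int k"]) (auto simp: bounded_periodic_def)
    qed
    then obtain x where x: "\<And>n. x n \<in> {0..1}" "\<And>n. v n (x n) + e < u (x n)" by metis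
    have "seq_compact {0..1::real}" using compact_eq_seq_compact_metric compact_Icc by blast
    then obtain a r where a: "a \<in> {0..1}" "strict_mono r" "(x \<circ> r) \<longlonglongrightarrow> a"
      using x(1) by (metis seq_compactE)
    have "v (Suc m) a + e \<le> u a" for m
    proof (rule LIMSEQ_le)
      have c: "isCont (v (Suc m)) a" "isCont u a"
        using vcont[of m] cont by (auto simp: continuous_on_eq_continuous_at)
      show "(\<lambda>n. v (Suc m) ((x \<circ> r) n) + e) \<longlonglongrightarrow> v (Suc m) a + e"
        by (rule tendsto_add[OF isCont_tendsto_compose[OF c(1) a(3)] tendsto_const])
      show "(\<lambda>n. u ((x \<circ> r) n)) \<longlonglongrightarrow> u a"
        by (rule isCont_tendsto_compose[OF c(2) a(3)])
      have "v (Suc m) (x (r n)) + e \<le> u (x (r n))" if "Suc m \<le> n" for n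
        using x(2)[of "r n"] incseqD[OF incr, of "Suc m" "r n" "x (r n)"]
          order_trans[OF that seq_suble[OF a(2), of n]] by simp
      then show "\<exists>N. \<forall>n\<ge>N. v (Suc m) ((x \<circ> r) n) + e \<le> u ((x \<circ> r) n)"
        by auto
    qed
    then have "u a + e \<le> u a"
      by (intro LIMSEQ_le_const2[OF tendsto_add[OF LIMSEQ_Suc[OF lim] tendsto_const]]) auto
    then show False using that by simp
  qed
  have ubp: "bounded_periodic u"
    using cont per by (rule continuous_periodic_imp_bounded_periodic)
  have "u x = lax_oleinik u x - s" for x
  proof (rule antisym)
    have "v (Suc n) x \<le> lax_oleinik u x - s" for n
      using lax_oleinik_mono[OF bp[of n] ubp, of 0 x] le step by simp
    then show "u x \<le> lax_oleinik u x - s"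
      by (intro LIMSEQ_le_const2[OF LIMSEQ_Suc[OF lim]]) auto
    show "lax_oleinik u x - s \<le> u x"
    proof (rule field_le_epsilon)
      fix e :: real assume "0 < e"
      then obtain n where "\<And>x. u x \<le> v n x + e" using unif by blast
      then show "lax_oleinik u x - s \<le> u x + e"
        using lax_oleinik_mono[OF ubp bp[of n], of e x] le[of "Suc n" x] step[of n x] by simp
    qed
  qed
  then have "weak_solution s u" using cont per by (simp add: weak_solution_def)
  then show ?thesis using le unif that by blast
qed

lemma bounded_periodic_const: "bounded_periodic (\<lambda>_. a)"
  by (simp add: bounded_periodic_def periodic1_def image_constant_conv)

lemma bounded_periodic_add:
  assumes "bounded_periodic u"
  shows "bounded_periodic (\<lambda>x. u x + a)"
proof -
  have "range (\<lambda>x. u x + a) = (\<lambda>y. y + a) ` range u" by auto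
  then show ?thesis
    using assms bounded_translation[of "range u" a]
    by (simp add: bounded_periodic_def periodic1_def add.commute)
qed

text \<open>All the iterates have oscillation at most \<open>K\<close>, so that up to \<open>K\<close> the value \<open>a n\<close> of the \<open>n\<close>-th
iterate at \<open>0\<close> is additive in \<open>n\<close>. Then \<open>n (a k - K) \<le> a (n k) \<le> k (a n + K)\<close>, which says that
every quotient \<open>(a k - K) / k\<close> lies below every quotient \<open>(a n + K) / n\<close>; any number between
the two families is a rate \<open>s\<close> of the drift.\<close>

lemma linear_drift:
  obtains s B where "\<And>n x. \<bar>(lax_oleinik ^^ n) (\<lambda>_. 0) x - real n * s\<bar> \<le> B"
proof -
  define T where "T n = (lax_oleinik ^^ n) (\<lambda>_. 0)" for n
  define a where "a n = T n 0" for n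
  have bp_iter: "bounded_periodic u \<Longrightarrow> bounded_periodic ((lax_oleinik ^^ n) u)" for n u
    by (induction n) (auto intro: lax_oleinik_bounded_periodic)
  obtain K where K: "0 \<le> K"
    "\<And>u x x'. bounded_periodic u \<Longrightarrow> lax_oleinik u x \<le> lax_oleinik u x' + K"
    by (rule lax_oleinik_oscillation) blast
  have osc: "T n x \<le> T n x' + K" for n x x'
    using K bp_iter[OF bounded_periodic_const, of _ 0] by (cases n) (auto simp: T_def)
  have iter_mono: "(lax_oleinik ^^ n) u x \<le> (lax_oleinik ^^ n) v x + b"
    if "bounded_periodic u" "bounded_periodic v" "\<And>x. u x \<le> v x + b" for n u v x b
    using that(3) by (induction n arbitrary: x) (auto intro!: lax_oleinik_mono bp_iter that(1,2))
  have add: "T (n + k) x = (lax_oleinik ^^ n) (T k) x" for n k x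
    by (simp add: T_def funpow_add)
  have bpT: "bounded_periodic (T k)" for k
    unfolding T_def by (intro bp_iter bounded_periodic_const)
  have sub: "a (n + k) \<le> a n + (a k + K)" for n k
    using iter_mono[OF bpT bounded_periodic_const, of k 0 "a k + K" n 0] osc[of k _ 0]
    by (simp only: add[symmetric] a_def T_def[of n, symmetric]) simp
  have super: "a n \<le> a (n + k) + (K - a k)" for n k
    using iter_mono[OF bounded_periodic_const bpT, of 0 k "K - a k" n 0] osc[of k 0]
    by (simp only: add[symmetric] a_def T_def[of n, symmetric]) (simp add: algebra_simps)
  have a0: "a 0 = 0" by (simp add: a_def T_def)
  have mult_le: "a (m * k) \<le> real m * (a k + K)" for m k
  proof (induction m)
    case (Suc m)
    then show ?case using sub[of "m * k" k] by (simp add: algebra_simps)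
  qed (simp add: a0)
  have mult_ge: "real m * (a k - K) \<le> a (m * k)" for m k
  proof (induction m)
    case (Suc m)
    then show ?case using super[of "m * k" k] by (simp add: algebra_simps)
  qed (simp add: a0)
  define s where "s = (SUP k. (a (Suc k) - K) / real (Suc k))"
  have cross: "(a (Suc k) - K) / real (Suc k) \<le> (a (Suc n) + K) / real (Suc n)" for k n
  proof -
    have "real (Suc n) * (a (Suc k) - K) \<le> real (Suc k) * (a (Suc n) + K)"
      using mult_ge[of "Suc n" "Suc k"] mult_le[of "Suc k" "Suc n"] by (simp add: mult.commute)
    then show ?thesis by (simp add: divide_simps mult.commute del: of_nat_Suc)
  qed
  have "s \<le> (a (Suc n) + K) / real (Suc n)" for n
    unfolding s_def by (intro cSUP_least cross) auto
  moreover have "(a (Suc n) - K) / real (Suc n) \<le> s" for n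
    unfolding s_def
    by (intro cSUP_upper bdd_aboveI[of _ "(a (Suc 0) + K) / real (Suc 0)"])
       (auto simp del: of_nat_Suc intro!: cross)
  ultimately have Suc: "\<bar>a (Suc n) - real (Suc n) * s\<bar> \<le> K" for n
    by (simp add: divide_simps abs_le_iff algebra_simps del: of_nat_Suc)
  have drift: "\<bar>a n - real n * s\<bar> \<le> K" for n
    using Suc a0 K(1) by (cases n) auto
  have "\<bar>T n x - real n * s\<bar> \<le> 2 * K" for n x
    using drift[of n] osc[of n x 0] osc[of n 0 x] unfolding a_def by linarith
  then show ?thesis using that unfolding T_def by blast
qed

text \<open>After the drift has been subtracted the iterates stay bounded. The lower limit of this sequence is a
fixed point: the operator is an infimum, so it commutes with the infima over tails, and these infima
increase to the lower limit.\<close>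

lemma weak_solution_exists: obtains s u where "weak_solution s u"
proof -
  obtain s B where B: "\<And>n x. \<bar>(lax_oleinik ^^ n) (\<lambda>_. 0) x - real n * s\<bar> \<le> B"
    by (rule linear_drift) blast
  define w where "w n x = (lax_oleinik ^^ n) (\<lambda>_. 0) x - real n * s" for n x
  define v where "v n x = (INF k. w (n + k) x)" for n x
  have wB: "\<bar>w n x\<bar> \<le> B" for n x using B by (simp add: w_def)
  have iter: "bounded_periodic ((lax_oleinik ^^ n) (\<lambda>_. 0))" for n
    by (induction n) (auto intro: lax_oleinik_bounded_periodic bounded_periodic_const)
  have wbp: "bounded_periodic (w n)" for n
    using bounded_periodic_add[OF iter, of n "- (real n * s)"] by (simp add: w_def[abs_def])
  have wstep: "w (Suc n) x = lax_oleinik (w n) x - s" for n x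
    using lax_oleinik_add_const[OF iter bounded_periodic_add[OF iter], of n "- (real n * s)" x]
    by (simp add: w_def[abs_def] algebra_simps)
  have bdd: "bdd_below (range (\<lambda>k. w (n + k) x))" for n x
    using wB by (intro bdd_belowI[of _ "- B"]) (auto simp: abs_le_iff minus_le_iff)
  have vle: "v n x \<le> w (n + k) x" for n k x
    unfolding v_def by (rule cINF_lower[OF bdd]) simp
  have vge: "b \<le> v n x" if "\<And>k. b \<le> w (n + k) x" for b n x
    unfolding v_def using that by (intro cINF_greatest) auto
  have vB: "\<bar>v n x\<bar> \<le> B" for n x
  proof -
    have "- B \<le> v n x" using wB by (intro vge) (simp add: abs_le_iff minus_le_iff)
    then show ?thesis using vle[of n x 0] wB[of n x] by simp
  qed
  have vbp: "bounded_periodic (v n)" for n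
    unfolding bounded_periodic_def
  proof
    show "periodic1 (v n)"
      using wbp by (simp add: v_def periodic1_def bounded_periodic_def)
    show "bounded (range (v n))" using vB by (auto simp: bounded_iff)
  qed
  have "v (Suc n) x = lax_oleinik (v n) x - s" for n x
  proof (rule antisym)
    have "v (Suc n) x + s \<le> lax_oleinik (v n) x"
    proof (rule lax_oleinik_greatest)
      show "periodic1 (v n)" using vbp by (simp add: bounded_periodic_def)
      fix y
      have "v (Suc n) x + s - L y x \<le> v n y"
      proof (rule vge)
        fix k show "v (Suc n) x + s - L y x \<le> w (n + k) y"
          using vle[of "Suc n" x k] wstep[of "n + k" x] lax_oleinik_le[OF wbp, of "n + k" x y] by simp
      qed
      then show "v (Suc n) x + s \<le> v n y + L y x" by simp
    qed
    then show "v (Suc n) x \<le> lax_oleinik (v n) x - s" by simp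
    show "lax_oleinik (v n) x - s \<le> v (Suc n) x"
    proof (rule vge)
      fix k show "lax_oleinik (v n) x - s \<le> w (Suc n + k) x"
        using lax_oleinik_mono[OF vbp wbp, of n "n + k" 0 x] vle wstep[of "n + k" x] by simp
    qed
  qed
  moreover have "v n x \<le> v (Suc n) x" for n x
    by (rule vge) (use vle[of n x "Suc _"] in simp)
  moreover have "v n x \<le> B" for n x using vB[of n x] by simp
  ultimately show ?thesis using increasing_iterates_converge[OF vbp] that by metis
qed

text \<open>The two equations are compared at a point where \<open>u - u'\<close> is maximal: a source that is optimal
for \<open>u'\<close> at that point is admissible for \<open>u\<close>.\<close>

lemma weak_solution_constant_le:
  assumes "weak_solution s u" "weak_solution s' u'"
  shows "s \<le> s'"
proof -
  have "bounded_periodic u" "bounded_periodic u'" 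
    using assms weak_solution_bounded_periodic by auto
  have "continuous_on {0..1} (\<lambda>x. u x - u' x)"
    using assms by (intro continuous_intros) (auto simp: weak_solution_def intro: continuous_on_subset)
  then obtain a where a: "a \<in> {0..1}" "\<And>x. x \<in> {0..1} \<Longrightarrow> u x - u' x \<le> u a - u' a"
    using continuous_attains_sup[of "{0..1}" "\<lambda>x. u x - u' x"] by auto
  have max: "u x - u' x \<le> u a - u' a" for x
  proof -
    obtain k :: int where k: "0 \<le> x + of_int k - 0" "x + of_int k - 0 \<le> 1"
      by (rule int_translate_near)
    then show ?thesis
      using a(2)[of "x + of_int k"] assms periodic1_add_int[of u x k] periodic1_add_int[of u' x k]
      unfolding weak_solution_def by simp
  qed
  obtain y where y: "lax_oleinik u' a = u' y + L y a"
    using lax_oleinik_attained[of u' a] assms(2) unfolding weak_solution_def by metis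
  have "u a + s \<le> u y + L y a"
    using lax_oleinik_le[OF \<open>bounded_periodic u\<close>, of a y] assms(1)
    unfolding weak_solution_def by (metis diff_add_cancel)
  moreover have "u' a + s' = u' y + L y a"
    using y assms(2) unfolding weak_solution_def by (metis diff_add_cancel)
  ultimately show "s \<le> s'" using max[of y] by simp
qed

definition is_sub_action :: "real \<Rightarrow> (real \<Rightarrow> real) \<Rightarrow> bool" where
  "is_sub_action s v \<longleftrightarrow> continuous_on UNIV v \<and> periodic1 v \<and> (\<forall>x y. v y - v x \<le> L x y - s)"

lemma weak_solution_imp_sub_action:
  assumes "weak_solution s u"
  shows "is_sub_action s u"
  unfolding is_sub_action_def
proof (intro conjI allI)
  show "continuous_on UNIV u" "periodic1 u" using assms by (auto simp: weak_solution_def)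
  have bp: "bounded_periodic u" using assms by (rule weak_solution_bounded_periodic)
  have eq: "u y = lax_oleinik u y - s" for y using assms by (simp add: weak_solution_def)
  show "u y - u x \<le> L x y - s" for x y
    using lax_oleinik_le[OF bp, of y x] eq[of y] by linarith
qed

lemma sub_action_bounded_periodic: "is_sub_action s v \<Longrightarrow> bounded_periodic v"
  unfolding is_sub_action_def by (blast intro: continuous_periodic_imp_bounded_periodic)

lemma sub_action_le_lax_oleinik:
  assumes "is_sub_action s v"
  shows "v x + s \<le> lax_oleinik v x"
  using assms by (intro lax_oleinik_greatest) (auto simp: is_sub_action_def algebra_simps)

lemma lax_oleinik_sub_action:
  assumes "is_sub_action s v"
  shows "is_sub_action s (lax_oleinik v)"
  unfolding is_sub_action_def
proof (intro conjI allI)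
  have bp: "bounded_periodic v" using assms by (rule sub_action_bounded_periodic)
  show "continuous_on UNIV (lax_oleinik v)" "periodic1 (lax_oleinik v)"
    using bp by (simp_all add: lax_oleinik_continuous lax_oleinik_periodic)
  show "lax_oleinik v y - lax_oleinik v x \<le> L x y - s" for x y
    using lax_oleinik_le[OF bp, of y x] sub_action_le_lax_oleinik[OF assms, of x] by simp
qed

text \<open>The iterates of a sub-action \<open>v\<close> increase to a weak solution \<open>u\<close> above it. Along a forward orbit
\<open>x 0, x 1, \<dots>\<close> that is calibrated by \<open>u\<close>, the gap \<open>u - v\<close> at \<open>x 0\<close> is at most the gap between \<open>u\<close> and
the \<open>n\<close>-th iterate at \<open>x n\<close>: the orbit segment competes in the minimization that defines this iterate,
and \<open>u\<close> grows along it by exactly its cost. As the convergence is uniform, the gap at \<open>x 0\<close> vanishes.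
This is what allows to transfer calibration from weak solutions to arbitrary sub-actions.\<close>

lemma sub_action_below_weak_solution:
  assumes v: "is_sub_action s v" and "weak_solution s u0"
  obtains u where "weak_solution s u" "\<And>x. v x \<le> u x"
    "\<And>x. (\<And>i. u (x (Suc i)) - u (x i) = L (x i) (x (Suc i)) - s) \<Longrightarrow> u (x 0) = v (x 0)"
proof -
  define w where "w n x = (lax_oleinik ^^ n) v x - real n * s" for n x
  have bpv: "bounded_periodic v" using v by (rule sub_action_bounded_periodic)
  have iter: "bounded_periodic ((lax_oleinik ^^ n) v)" for n
    by (induction n) (auto intro: lax_oleinik_bounded_periodic bpv)
  have wbp: "bounded_periodic (w n)" for n
    using bounded_periodic_add[OF iter, of n "- (real n * s)"] by (simp add: w_def[abs_def])
  have wstep: "w (Suc n) x = lax_oleinik (w n) x - s" for n x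
    using lax_oleinik_add_const[OF iter bounded_periodic_add[OF iter], of n "- (real n * s)" x]
    by (simp add: w_def[abs_def] algebra_simps)
  have w0: "w 0 = v" by (simp add: w_def[abs_def])
  have inc: "w n x \<le> w (Suc n) x" for n x
  proof (induction n arbitrary: x)
    case 0
    then show ?case using sub_action_le_lax_oleinik[OF v, of x] wstep[of 0 x] by (simp add: w0)
  next
    case (Suc n)
    then show ?case
      using lax_oleinik_mono[OF wbp wbp, of n "Suc n" 0 x] wstep[of n x] wstep[of "Suc n" x] by simp
  qed
  have bp0: "bounded_periodic u0" using assms(2) by (rule weak_solution_bounded_periodic)
  obtain B0 where B0: "\<And>x. \<bar>u0 x\<bar> \<le> B0"
    using bp0 unfolding bounded_periodic_def bounded_iff by auto
  obtain B where B: "\<And>x. \<bar>v x\<bar> \<le> B"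
    using bpv unfolding bounded_periodic_def bounded_iff by auto
  have "w n x \<le> u0 x + (B + B0)" for n x
  proof (induction n arbitrary: x)
    case 0
    show ?case using B[of x] B0[of x] unfolding w0 by linarith
  next
    case (Suc n)
    have "u0 x = lax_oleinik u0 x - s" using assms(2) by (simp add: weak_solution_def)
    then show ?case
      using lax_oleinik_mono[OF wbp bp0 Suc, of x] wstep[of n x] by simp
  qed
  then have wB: "w n x \<le> B0 + (B + B0)" for n x
    using B0[of x] by (smt (verit))
  obtain u where u: "weak_solution s u" "\<And>n x. w n x \<le> u x"
    "\<And>e. 0 < e \<Longrightarrow> \<exists>n. \<forall>x. u x \<le> w n x + e"
    using increasing_iterates_converge[where v = w, OF wbp wstep inc wB] by metis
  show ?thesis
  proof
    show "weak_solution s u" by fact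
    show vu: "v x \<le> u x" for x using u(2)[of 0] by (simp add: w0)
    fix x assume orbit: "\<And>i. u (x (Suc i)) - u (x i) = L (x i) (x (Suc i)) - s"
    have along: "w n (x n) - u (x n) \<le> v (x 0) - u (x 0)" for n
    proof (induction n)
      case 0
      then show ?case by (simp add: w0)
    next
      case (Suc n)
      then show ?case
        using wstep[of n "x (Suc n)"] lax_oleinik_le[OF wbp, of n "x (Suc n)" "x n"] orbit[of n] by simp
    qed
    have "u (x 0) \<le> v (x 0)"
    proof (rule field_le_epsilon)
      fix e :: real assume "0 < e"
      then obtain n where "\<And>x. u x \<le> w n x + e" using u(3) by blast
      then show "u (x 0) \<le> v (x 0) + e" using along[of n] by (smt (verit))
    qed
    then show "u (x 0) = v (x 0)" using vu by (simp add: antisym)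
  qed
qed

definition calibrated :: "real \<Rightarrow> (real \<Rightarrow> real) \<Rightarrow> real \<Rightarrow> real \<Rightarrow> bool" where
  "calibrated s v x y \<longleftrightarrow> v y - v x = L x y - s"

lemma weak_solution_calibrated_source:
  assumes "weak_solution s u"
  obtains w where "\<bar>w - x\<bar> \<le> R" "calibrated s u w x"
proof -
  obtain w where "\<bar>w - x\<bar> \<le> R" "lax_oleinik u x = u w + L w x"
    using assms lax_oleinik_attained[of u x] unfolding weak_solution_def by metis
  moreover have "u x = lax_oleinik u x - s" using assms by (simp add: weak_solution_def)
  ultimately show ?thesis using that by (simp add: calibrated_def)
qed

lemma forward_maximizer_exists:
  assumes "continuous_on UNIV u" "periodic1 u"
  obtains y where "\<And>z. u z - L x z \<le> u y - L x y"
proof -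
  interpret swap: periodic_cost "\<lambda>x y. L y x" R by (rule swapped_periodic_cost)
  have u: "continuous_on UNIV (\<lambda>t. - u t)" "periodic1 (\<lambda>t. - u t)"
    using assms by (auto intro: continuous_on_minus simp: periodic1_def)
  obtain y where y: "swap.lax_oleinik (\<lambda>t. - u t) x = - u y + L x y"
    using swap.lax_oleinik_attained[OF u] by metis
  show ?thesis
    using that[of y] swap.lax_oleinik_le[OF continuous_periodic_imp_bounded_periodic[OF u], of x] y
    by (simp add: algebra_simps)
qed

text \<open>The hypothesis is applied to the forward Lax--Oleinik transform of \<open>v\<close>, which is again a sub-action.
It can grow by the full cost from \<open>x\<close> to \<open>y\<close> only if its value at \<open>y\<close>, a supremum, is as large as
\<open>v\<close> being a sub-action permits, that is, only if a point attaining this supremum is calibrated with \<open>y\<close>.\<close>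

lemma universally_calibrated_target:
  assumes univ: "\<And>v. is_sub_action s v \<Longrightarrow> calibrated s v x y"
    and v: "is_sub_action s v"
  obtains z where "calibrated s v y z"
proof -
  interpret swap: periodic_cost "\<lambda>x y. L y x" R by (rule swapped_periodic_cost)
  have "swap.is_sub_action s (\<lambda>t. - v t)"
    unfolding swap.is_sub_action_def
  proof (intro conjI allI)
    show "continuous_on UNIV (\<lambda>t. - v t)" "periodic1 (\<lambda>t. - v t)"
      using v by (auto intro: continuous_on_minus simp: is_sub_action_def periodic1_def)
    have "v a - v b \<le> L b a - s" for a b using v by (simp add: is_sub_action_def)
    then show "- v b - - v a \<le> L b a - s" for a b by simp
  qed
  note v' = this and w' = swap.lax_oleinik_sub_action[OF this]
  \<comment> \<open>the forward transform of \<open>v\<close> is the negative of the backward transform of \<open>- v\<close> for the swapped cost\<close>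
  have cp: "continuous_on UNIV (\<lambda>t. - v t)" "periodic1 (\<lambda>t. - v t)"
    using v' by (auto simp: swap.is_sub_action_def)
  let ?w = "\<lambda>t. - swap.lax_oleinik (\<lambda>t. - v t) t"
  have "is_sub_action s ?w"
    unfolding is_sub_action_def
  proof (intro conjI allI)
    show "continuous_on UNIV ?w" "periodic1 ?w"
      using w' by (auto intro: continuous_on_minus simp: swap.is_sub_action_def periodic1_def)
    show "?w b - ?w a \<le> L a b - s" for a b
      using w' by (simp add: swap.is_sub_action_def)
  qed
  then have "calibrated s ?w x y" by (rule univ)
  moreover have "swap.lax_oleinik (\<lambda>t. - v t) x \<le> - v y + L x y"
    by (rule swap.lax_oleinik_le[OF swap.sub_action_bounded_periodic[OF v']])
  moreover obtain z where z: "swap.lax_oleinik (\<lambda>t. - v t) y = - v z + L y z"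
    using swap.lax_oleinik_attained[OF cp] by metis
  moreover have "v z - v y \<le> L y z - s" using v by (simp add: is_sub_action_def)
  ultimately have "calibrated s v y z" by (simp add: calibrated_def)
  then show ?thesis using that by blast
qed

end

section \<open>One-sided contact and superdifferentials\<close>

lemma derivatives_agree_if_touching:
  fixes u \<psi> :: "real \<Rightarrow> real"
  assumes "(u has_real_derivative a) (at x)" "(\<psi> has_real_derivative b) (at x)"
    and "\<And>t. u t \<le> \<psi> t" "u x = \<psi> x"
  shows "a = b"
proof -
  have "((\<lambda>t. \<psi> t - u t) has_real_derivative (b - a)) (at x)"
    using assms by (auto intro!: derivative_intros)
  then have "b - a = 0"
    by (rule DERIV_local_min[of _ _ _ 1]) (use assms in auto)
  then show ?thesis by simp
qed

lemma has_real_derivative_between: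
  fixes u \<phi> \<psi> :: "real \<Rightarrow> real"
  assumes \<phi>: "(\<phi> has_real_derivative a) (at x)" and \<psi>: "(\<psi> has_real_derivative b) (at x)"
    and le: "\<And>t. \<phi> t \<le> u t" "\<And>t. u t \<le> \<psi> t" and eq: "\<phi> x = u x" "u x = \<psi> x"
  shows "(u has_real_derivative a) (at x)" "a = b"
proof -
  show "a = b"
    by (rule derivatives_agree_if_touching[OF \<phi> \<psi>]) (use le eq in \<open>auto intro: order_trans\<close>)
  let ?q = "\<lambda>g t. (g t - g x) / (t - x) - a"
  have lim: "(?q g \<longlongrightarrow> 0) (at x)" if "(g has_real_derivative a) (at x)" for g
    using that unfolding has_field_derivative_iff by (rule LIM_zero)
  have between: "\<bar>?q u t\<bar> \<le> \<bar>?q \<phi> t\<bar> + \<bar>?q \<psi> t\<bar>" for t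
  proof -
    have "\<phi> t - \<phi> x \<le> u t - u x" "u t - u x \<le> \<psi> t - \<psi> x"
      using le eq by auto
    then consider "?q \<phi> t \<le> ?q u t" "?q u t \<le> ?q \<psi> t" | "?q \<psi> t \<le> ?q u t" "?q u t \<le> ?q \<phi> t"
      using divide_right_mono divide_right_mono_neg by (metis diff_right_mono linear)
    then show ?thesis by cases linarith+
  qed
  have "((\<lambda>t. \<bar>?q \<phi> t\<bar> + \<bar>?q \<psi> t\<bar>) \<longlongrightarrow> 0) (at x)"
    using tendsto_add[OF tendsto_rabs_zero[OF lim] tendsto_rabs_zero[OF lim]] \<phi> \<psi> \<open>a = b\<close> by simp
  then have "(?q u \<longlongrightarrow> 0) (at x)"
    by (rule Lim_null_comparison[rotated]) (use between in auto)
  then show "(u has_real_derivative a) (at x)"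
    unfolding has_field_derivative_iff by (rule LIM_zero_cancel)
qed

lemma superdiff_iff:
  "p \<in> superdiff u x \<longleftrightarrow> (\<forall>e>0. \<forall>\<^sub>F y in at x. u y - u x - p * (y - x) < e * \<bar>y - x\<bar>)"
proof -
  let ?q = "\<lambda>y. (u y - u x - p * (y - x)) / \<bar>y - x\<bar>"
  have ev: "(\<forall>\<^sub>F y in at x. ereal (?q y) < ereal e) \<longleftrightarrow>
      (\<forall>\<^sub>F y in at x. u y - u x - p * (y - x) < e * \<bar>y - x\<bar>)" for e
    by (rule eventually_cong[OF eventually_neq_at_within[of x]]) (simp add: divide_less_eq)
  have "p \<in> superdiff u x \<longleftrightarrow> (\<forall>e>0. \<forall>\<^sub>F y in at x. ereal (?q y) < e)"
    by (simp add: superdiff_def Limsup_le_iff)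
  also have "\<dots> \<longleftrightarrow> (\<forall>e>0. \<forall>\<^sub>F y in at x. ereal (?q y) < ereal e)"
  proof (intro iffI allI impI)
    fix e :: ereal assume *: "\<forall>e>0. \<forall>\<^sub>F y in at x. ereal (?q y) < ereal e" and "0 < e"
    obtain r where r: "0 < ereal r" "ereal r < e" using \<open>0 < e\<close> ereal_dense2 by blast
    then have "\<forall>\<^sub>F y in at x. ereal (?q y) < ereal r" using * by simp
    then show "\<forall>\<^sub>F y in at x. ereal (?q y) < e"
      by eventually_elim (rule less_trans[OF _ r(2)])
  next
    fix e :: real assume "\<forall>e>0. \<forall>\<^sub>F y in at x. ereal (?q y) < e" "0 < e"
    then show "\<forall>\<^sub>F y in at x. ereal (?q y) < ereal e" by (metis ereal_less(2))
  qed
  finally show ?thesis by (simp only: ev)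
qed

lemma superdiff_if_touched_from_above:
  assumes "(\<psi> has_real_derivative p) (at x)" "\<And>t. u t \<le> \<psi> t" "u x = \<psi> x"
  shows "p \<in> superdiff u x"
  unfolding superdiff_iff
proof (intro allI impI)
  fix e :: real assume "0 < e"
  have "\<forall>\<^sub>F t in at x. \<bar>(\<psi> t - \<psi> x) / (t - x) - p\<bar> < e"
    using assms(1) \<open>0 < e\<close> unfolding has_field_derivative_iff tendsto_iff by (simp add: dist_real_def)
  moreover have "\<forall>\<^sub>F t in at x. t \<noteq> x" by (simp add: eventually_at_filter)
  ultimately show "\<forall>\<^sub>F t in at x. u t - u x - p * (t - x) < e * \<bar>t - x\<bar>"
  proof eventually_elim
    case (elim t)
    have "(\<psi> t - \<psi> x) / (t - x) - p = (\<psi> t - \<psi> x - p * (t - x)) / (t - x)"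
      using elim by (simp add: diff_divide_distrib)
    then have "\<bar>\<psi> t - \<psi> x - p * (t - x)\<bar> < e * \<bar>t - x\<bar>"
      using elim by (simp add: abs_divide pos_divide_less_eq)
    then show ?case using assms(2)[of t] assms(3) by linarith
  qed
qed

text \<open>Near \<open>x\<close> the difference quotients of \<open>u\<close> are close to \<open>d\<close> on both sides, while a supergradient \<open>p\<close>
is, up to small errors, an upper bound for them on the right and a lower bound on the left.\<close>

lemma superdiff_eq_derivative:
  assumes "(u has_real_derivative d) (at x)" "p \<in> superdiff u x"
  shows "p = d"
proof (rule ccontr)
  assume "p \<noteq> d"
  define e where "e = \<bar>p - d\<bar> / 2"
  have e: "0 < e" using \<open>p \<noteq> d\<close> by (simp add: e_def)
  have "\<forall>\<^sub>F t in at x. \<bar>(u t - u x) / (t - x) - d\<bar> < e"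
    using assms(1) e unfolding has_field_derivative_iff tendsto_iff by (simp add: dist_real_def)
  moreover have "\<forall>\<^sub>F t in at x. u t - u x - p * (t - x) < e * \<bar>t - x\<bar>"
    using assms(2) e by (simp add: superdiff_iff)
  ultimately have "\<forall>\<^sub>F t in at x. \<bar>(u t - u x) / (t - x) - d\<bar> < e \<and>
      u t - u x - p * (t - x) < e * \<bar>t - x\<bar>" by (rule eventually_conj)
  then obtain r where r: "0 < r" "\<And>t. t \<noteq> x \<Longrightarrow> dist t x < r \<Longrightarrow>
      \<bar>(u t - u x) / (t - x) - d\<bar> < e \<and> u t - u x - p * (t - x) < e * \<bar>t - x\<bar>"
    unfolding eventually_at by auto
  \<comment> \<open>probe on the side of \<open>x\<close> where the line of slope \<open>p\<close> lies below the tangent\<close>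
  define t where "t = x + (if p < d then r / 2 else - r / 2)"
  have t: "t \<noteq> x" "dist t x < r" using r(1) by (auto simp: t_def dist_real_def)
  define q where "q = (u t - u x) / (t - x)"
  have q: "u t - u x = q * (t - x)" using t by (simp add: q_def)
  have 2: "\<bar>q - d\<bar> < e" "(q - p) * (t - x) < e * \<bar>t - x\<bar>"
    using r(2)[OF t] unfolding left_diff_distrib q[symmetric] by (simp_all add: q_def)
  show False
  proof (cases "p < d")
    case True
    then have "t - x = r / 2" by (simp add: t_def)
    then have "q - p < e" using 2 r(1) by simp
    then show False using 2(1) True by (simp add: e_def)
  next
    case False
    then have "t - x = - (r / 2)" by (simp add: t_def)
    then have "(q - p) * (t - x) = (p - q) * (r / 2)" "\<bar>t - x\<bar> = r / 2"
      using r(1) by (simp_all only: mult_minus_right minus_mult_left minus_diff_eq)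
    then have "(p - q) * (r / 2) < e * (r / 2)" using 2(2) by metis
    then have "p - q < e" using r(1) by simp
    then show False using 2(1) False \<open>p \<noteq> d\<close> by (simp add: e_def)
  qed
qed

section \<open>Twist, growth and coercivity of generating functions\<close>

lemma C2_map_partials:
  fixes S :: "real \<times> real \<Rightarrow> real"
  assumes "C2_map S"
  shows "((\<lambda>t. S (t, y)) has_real_derivative d1 S x y) (at x)"
    and "((\<lambda>t. S (x, t)) has_real_derivative d2 S x y) (at y)"
    and "continuous_on UNIV (\<lambda>z. d2 S (fst z) (snd z))"
    and "((\<lambda>t. d2 S t y) has_real_derivative deriv (\<lambda>t. d2 S t y) x) (at x)"
    and "continuous_on UNIV S"
proof -
  obtain g :: "real \<times> real \<Rightarrow> (real \<times> real) \<Rightarrow>\<^sub>L real"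
    where g: "\<And>z. (S has_derivative blinfun_apply (g z)) (at z)" and "C1_map g"
    using assms unfolding C2_map_def by auto
  obtain h where h: "\<And>z. (g has_derivative blinfun_apply (h z)) (at z)"
    using \<open>C1_map g\<close> unfolding C1_map_def by auto
  have 1: "((\<lambda>t. S (t, y)) has_real_derivative g (x, y) (1, 0)) (at x)" for x y
  proof -
    have "((\<lambda>t. S (t, y)) has_derivative (\<lambda>t. g (x, y) (t, 0))) (at x)"
      by (rule has_derivative_compose[OF _ g, of "\<lambda>t. (t, y)"]) (auto intro!: derivative_eq_intros)
    moreover have "(\<lambda>t. g (x, y) (t, 0)) = (*) (g (x, y) (1, 0))"
    proof
      show "g (x, y) (t, 0) = g (x, y) (1, 0) * t" for t
        using blinfun.scaleR_right[of "g (x, y)" t "(1, 0)"] by (simp add: mult.commute)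
    qed
    ultimately show ?thesis unfolding has_field_derivative_def by metis
  qed
  have 2: "((\<lambda>t. S (x, t)) has_real_derivative g (x, y) (0, 1)) (at y)" for x y
  proof -
    have "((\<lambda>t. S (x, t)) has_derivative (\<lambda>t. g (x, y) (0, t))) (at y)"
      by (rule has_derivative_compose[OF _ g, of "\<lambda>t. (x, t)"]) (auto intro!: derivative_eq_intros)
    moreover have "(\<lambda>t. g (x, y) (0, t)) = (*) (g (x, y) (0, 1))"
    proof
      show "g (x, y) (0, t) = g (x, y) (0, 1) * t" for t
        using blinfun.scaleR_right[of "g (x, y)" t "(0, 1)"] by (simp add: mult.commute)
    qed
    ultimately show ?thesis unfolding has_field_derivative_def by metis
  qed
  show "((\<lambda>t. S (t, y)) has_real_derivative d1 S x y) (at x)"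
    using 1 DERIV_imp_deriv by metis
  show "((\<lambda>t. S (x, t)) has_real_derivative d2 S x y) (at y)"
    using 2 DERIV_imp_deriv by metis
  have d2: "d2 S x y = g (x, y) (0, 1)" for x y by (rule DERIV_imp_deriv[OF 2])
  have "continuous_on UNIV g"
    by (intro continuous_at_imp_continuous_on ballI has_derivative_continuous[OF h])
  then show "continuous_on UNIV (\<lambda>z. d2 S (fst z) (snd z))"
    unfolding d2 prod.collapse by (intro continuous_intros)
  show "continuous_on UNIV S"
    by (intro continuous_at_imp_continuous_on ballI has_derivative_continuous[OF g])
  have "((\<lambda>t. g (t, y)) has_derivative (\<lambda>t. h (x, y) (t, 0))) (at x)"
    by (rule has_derivative_compose[OF _ h, of "\<lambda>t. (t, y)"]) (auto intro!: derivative_eq_intros)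
  then have "((\<lambda>t. g (t, y) (0, 1)) has_derivative (\<lambda>t. h (x, y) (t, 0) (0, 1))) (at x)"
    by (rule bounded_linear.has_derivative[OF blinfun.bounded_linear_left])
  then have "(\<lambda>t. d2 S t y) differentiable (at x)"
    unfolding d2 by (rule differentiableI)
  then show "((\<lambda>t. d2 S t y) has_real_derivative deriv (\<lambda>t. d2 S t y) x) (at x)"
    using DERIV_deriv_iff_real_differentiable by blast
qed

text \<open>Integrating the bound on the mixed derivative once replaces second derivatives by a quantitative
monotonicity of \<open>d2 S\<close> in its first argument.\<close>

lemma generating_function_twist:
  assumes "generating_function S F"
  shows "\<exists>\<epsilon>>0. \<forall>x x' y. x \<le> x' \<longrightarrow> \<epsilon> * (x' - x) \<le> d2 S x y - d2 S x' y"
proof -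
  obtain \<epsilon> where \<epsilon>: "0 < \<epsilon>" "\<And>x y. deriv (\<lambda>t. d2 S t y) x < - \<epsilon>"
    using assms unfolding generating_function_def by auto
  have C2: "C2_map S" using assms by (simp add: generating_function_def)
  show ?thesis
  proof (intro exI conjI allI impI)
    fix x x' y :: real assume "x \<le> x'"
    have "d2 S x' y + \<epsilon> * x' \<le> d2 S x y + \<epsilon> * x"
    proof (rule DERIV_nonpos_imp_nonincreasing[OF \<open>x \<le> x'\<close>])
      fix t
      have "((\<lambda>t. d2 S t y + \<epsilon> * t) has_real_derivative deriv (\<lambda>t. d2 S t y) t + \<epsilon>) (at t)"
        by (auto intro!: derivative_eq_intros C2_map_partials(4)[OF C2])
      then show "\<exists>d. ((\<lambda>t. d2 S t y + \<epsilon> * t) has_real_derivative d) (at t) \<and> d \<le> 0"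
        using \<epsilon>(2)[of y t] by (intro exI conjI) auto
    qed
    then show "\<epsilon> * (x' - x) \<le> d2 S x y - d2 S x' y" by (simp add: algebra_simps)
  qed (rule \<epsilon>(1))
qed

lemma generating_function_partials_shift:
  assumes "generating_function S F"
  shows "d1 S (x + 1) (y + 1) = d1 S x y" "d2 S (x + 1) (y + 1) = d2 S x y"
proof -
  have C2: "C2_map S" and per: "\<And>x y. S (x + 1, y + 1) = S (x, y)"
    using assms by (auto simp: generating_function_def)
  show "d1 S (x + 1) (y + 1) = d1 S x y"
  proof (rule DERIV_imp_deriv)
    have "((\<lambda>t. S (t + 1, y + 1)) has_real_derivative d1 S x y) (at x)"
      unfolding per by (rule C2_map_partials(1)[OF C2])
    then show "((\<lambda>t. S (t, y + 1)) has_real_derivative d1 S x y) (at (x + 1))"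
      by (simp only: DERIV_shift)
  qed
  show "d2 S (x + 1) (y + 1) = d2 S x y"
  proof (rule DERIV_imp_deriv)
    have "((\<lambda>t. S (x + 1, t + 1)) has_real_derivative d2 S x y) (at y)"
      unfolding per by (rule C2_map_partials(2)[OF C2])
    then show "((\<lambda>t. S (x + 1, t)) has_real_derivative d2 S x y) (at (y + 1))"
      by (simp only: DERIV_shift)
  qed
qed

text \<open>On the diagonal \<open>d2 S\<close> is bounded by periodicity. By the twist condition the slope of \<open>S (x, \<cdot>)\<close> at
\<open>t\<close> differs from the diagonal slope at \<open>t\<close> by at least \<open>\<epsilon> \<bar>t - x\<bar>\<close>, in the direction that makes \<open>S\<close>
grow away from the diagonal.\<close>

lemma generating_function_superlinear:
  assumes gen: "generating_function S F"
  shows "\<exists>\<epsilon>>0. \<exists>A B. \<forall>x y. \<epsilon> / 2 * (y - x)\<^sup>2 - B * \<bar>y - x\<bar> - A \<le> S (x, y)"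
proof -
  obtain \<epsilon> where \<epsilon>: "0 < \<epsilon>" "\<And>x x' y. x \<le> x' \<Longrightarrow> \<epsilon> * (x' - x) \<le> d2 S x y - d2 S x' y"
    using generating_function_twist[OF gen] by blast
  have C2: "C2_map S" and per: "\<And>x y. S (x + 1, y + 1) = S (x, y)"
    using gen by (auto simp: generating_function_def)
  note d2_per = generating_function_partials_shift(2)[OF gen]
  obtain B where B: "\<And>x y. \<bar>x - y\<bar> \<le> 0 \<Longrightarrow> \<bar>d2 S x y\<bar> \<le> B"
    using diagonal_periodic_bounded_on_strip[of "\<lambda>x y. d2 S x y" 0, OF C2_map_partials(3)[OF C2] d2_per]
    by blast
  have "continuous_on UNIV (\<lambda>z. S (fst z, snd z))" using C2_map_partials(5)[OF C2] by simp
  then obtain A where A: "\<And>x y. \<bar>x - y\<bar> \<le> 0 \<Longrightarrow> \<bar>S (x, y)\<bar> \<le> A"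
    using diagonal_periodic_bounded_on_strip[of "\<lambda>x y. S (x, y)" 0, OF _ per] by blast
  have right: "\<epsilon> / 2 * (y - x)\<^sup>2 - B * (y - x) - A \<le> S (x, y)" if "x \<le> y" for x y
  proof -
    let ?h = "\<lambda>t. S (x, t) + B * (t - x) - \<epsilon> / 2 * (t - x)\<^sup>2"
    have "?h x \<le> ?h y"
    proof (rule DERIV_nonneg_imp_nondecreasing[OF that])
      fix t assume "x \<le> t"
      have "(?h has_real_derivative d2 S x t + B - \<epsilon> * (t - x)) (at t)"
        by (auto intro!: derivative_eq_intros C2_map_partials(2)[OF C2])
      moreover have "0 \<le> d2 S x t + B - \<epsilon> * (t - x)"
        using \<epsilon>(2)[OF \<open>x \<le> t\<close>, of t] B[of t t] by (simp add: abs_le_iff)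
      ultimately show "\<exists>d. (?h has_real_derivative d) (at t) \<and> 0 \<le> d" by blast
    qed
    then show ?thesis using A[of x x] by (simp add: abs_le_iff)
  qed
  have left: "\<epsilon> / 2 * (y - x)\<^sup>2 - B * (x - y) - A \<le> S (x, y)" if "y \<le> x" for x y
  proof -
    let ?h = "\<lambda>t. S (x, t) - B * (t - x) - \<epsilon> / 2 * (t - x)\<^sup>2"
    have "?h x \<le> ?h y"
    proof (rule DERIV_nonpos_imp_nonincreasing[OF that])
      fix t assume "t \<le> x"
      have "(?h has_real_derivative d2 S x t - B - \<epsilon> * (t - x)) (at t)"
        by (auto intro!: derivative_eq_intros C2_map_partials(2)[OF C2])
      moreover have "d2 S x t - B - \<epsilon> * (t - x) \<le> 0"
        using \<epsilon>(2)[OF \<open>t \<le> x\<close>, of t] B[of t t] by (simp add: abs_le_iff algebra_simps)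
      ultimately show "\<exists>d. (?h has_real_derivative d) (at t) \<and> d \<le> 0" by blast
    qed
    then show ?thesis using A[of x x] by (simp add: abs_le_iff algebra_simps)
  qed
  have "\<epsilon> / 2 * (y - x)\<^sup>2 - B * \<bar>y - x\<bar> - A \<le> S (x, y)" for x y
    using left[of y x] right[of x y] by (cases "x \<le> y") auto
  then show ?thesis using \<epsilon>(1) by blast
qed

lemma generating_function_periodic_cost:
  assumes gen: "generating_function S F"
  obtains R where "periodic_cost (\<lambda>x y. S_coh S c (x, y)) R"
proof -
  obtain \<epsilon> A B where sup: "0 < \<epsilon>" "\<And>x y. \<epsilon> / 2 * (y - x)\<^sup>2 - B * \<bar>y - x\<bar> - A \<le> S (x, y)"
    using generating_function_superlinear[OF gen] by blast
  have C2: "C2_map S" and per: "\<And>x y. S (x + 1, y + 1) = S (x, y)"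
    using gen by (auto simp: generating_function_def)
  let ?L = "\<lambda>x y. S_coh S c (x, y)"
  have cont: "continuous_on UNIV (\<lambda>z. ?L (fst z) (snd z))"
    using C2_map_partials(5)[OF C2]
    by (simp add: S_coh_def case_prod_beta continuous_intros)
  have shift: "?L (x + 1) (y + 1) = ?L x y" for x y
    by (simp add: S_coh_def per)
  obtain C where C: "\<And>x y. \<bar>x - y\<bar> \<le> 1 \<Longrightarrow> \<bar>?L x y\<bar> \<le> C"
    using diagonal_periodic_bounded_on_strip[of ?L 1, OF cont shift] by blast
  \<comment> \<open>at distance \<open>r > 2 D / \<epsilon>\<close> the quadratic term exceeds \<open>D r\<close>, and \<open>D r\<close> absorbs the other terms when \<open>1 \<le> r\<close>\<close>
  define D where "D = \<bar>B\<bar> + \<bar>c\<bar> + \<bar>A\<bar> + \<bar>C\<bar> + 1"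
  have "periodic_cost ?L (1 + 2 * D / \<epsilon>)"
  proof
    show "continuous_on UNIV (\<lambda>z. ?L (fst z) (snd z))" by (rule cont)
    show "?L (x + 1) (y + 1) = ?L x y" for x y by (rule shift)
    show "1 \<le> 1 + 2 * D / \<epsilon>" using sup(1) by (simp add: D_def)
    fix x y x' y' :: real assume far: "1 + 2 * D / \<epsilon> < \<bar>x - y\<bar>" and near: "\<bar>x' - y'\<bar> \<le> 1"
    define r where "r = \<bar>y - x\<bar>"
    have D: "0 < D" by (simp add: D_def)
    have r: "1 \<le> r" "2 * D / \<epsilon> < r"
      using far D sup(1) unfolding r_def
      by (simp_all add: abs_minus_commute) (smt (verit) divide_pos_pos)+
    have "D * r \<le> \<epsilon> / 2 * r * r"
      using r sup(1) by (intro mult_right_mono) (auto simp: field_simps)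
    moreover have "D * r = (\<bar>B\<bar> + \<bar>c\<bar>) * r + (\<bar>A\<bar> + \<bar>C\<bar> + 1) * r" by (simp add: D_def algebra_simps)
    moreover have "\<bar>A\<bar> + \<bar>C\<bar> + 1 \<le> (\<bar>A\<bar> + \<bar>C\<bar> + 1) * r"
      using mult_left_mono[OF r(1), of "\<bar>A\<bar> + \<bar>C\<bar> + 1"] by simp
    moreover have "(y - x)\<^sup>2 = r * r" by (simp add: r_def power2_eq_square)
    moreover have "B * r \<le> \<bar>B\<bar> * r" using r(1) by (intro mult_right_mono) auto
    moreover have "- (c * (x - y)) \<le> \<bar>c\<bar> * r"
      unfolding r_def by (metis abs_ge_minus_self abs_minus_commute abs_mult)
    ultimately have "C < ?L x y"
      using sup(2)[of y x] unfolding S_coh_def by (simp add: algebra_simps r_def[symmetric]) argo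
    then show "?L x' y' < ?L x y" using C[OF near] by simp
  qed
  then show ?thesis by (rule that)
qed

section \<open>The twist diffeomorphism and its discrete weak KAM solutions\<close>

locale twist_system = periodic_cost "\<lambda>x y. S_coh S c (x, y)" R for S c R +
  fixes F :: "real \<times> real \<Rightarrow> real \<times> real"
  assumes generating: "generating_function S F"
    and F_continuous: "continuous_on UNIV F"
begin

abbreviation L :: "real \<Rightarrow> real \<Rightarrow> real" where "L x y \<equiv> S_coh S c (x, y)"

lemma C2_S: "C2_map S"
  using generating by (simp add: generating_function_def)

lemma F_eq_iff: "F (x, p) = (y, p') \<longleftrightarrow> p = - d1 S x y \<and> p' = d2 S x y"
  using generating by (simp add: generating_function_def)

lemma F_generated: "F (x, - d1 S x y) = (y, d2 S x y)"
  by (simp add: F_eq_iff)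

lemma F_cases: obtains x y where "z = (x, - d1 S x y)" "F z = (y, d2 S x y)"
  using F_eq_iff[of "fst z" "snd z" "fst (F z)" "snd (F z)"] that[of "fst z" "fst (F z)"]
  by (simp add: prod_eq_iff)

lemma d1_injective: "d1 S x y = d1 S x y' \<Longrightarrow> y = y'"
  by (metis F_generated prod.inject)

lemma d2_strict_antimono: "x < x' \<Longrightarrow> d2 S x' y < d2 S x y"
proof -
  assume "x < x'"
  obtain \<epsilon> where \<epsilon>: "0 < \<epsilon>" "\<And>x x' y. x \<le> x' \<Longrightarrow> \<epsilon> * (x' - x) \<le> d2 S x y - d2 S x' y"
    using generating_function_twist[OF generating] by blast
  have "0 < \<epsilon> * (x' - x)" using \<open>x < x'\<close> \<epsilon>(1) by simp
  also have "\<dots> \<le> d2 S x y - d2 S x' y" by (rule \<epsilon>(2)) (use \<open>x < x'\<close> in simp)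
  finally show ?thesis by simp
qed

lemma d2_injective: "d2 S x y = d2 S x' y \<Longrightarrow> x = x'"
  using d2_strict_antimono by (metis less_irrefl linorder_neqE_linordered_idom)

lemma F_injective: "inj F"
proof (rule injI)
  fix z z' assume eq: "F z = F z'"
  obtain x y where z: "z = (x, - d1 S x y)" "F z = (y, d2 S x y)" by (rule F_cases)
  obtain x' y' where z': "z' = (x', - d1 S x' y')" "F z' = (y', d2 S x' y')" by (rule F_cases)
  have "y = y'" "d2 S x y = d2 S x' y" using eq z(2) z'(2) by auto
  then show "z = z'" using z(1) z'(1) d2_injective[of x y x'] by simp
qed

text \<open>By the twist condition \<open>d2 S x y\<close> tends to infinity with \<open>\<bar>x\<bar>\<close>, with both signs, so it takes every
value \<open>q\<close>; the interval \<open>[-M, M]\<close> in the proof is where linear growth already forces this.\<close>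

lemma F_surjective: "surj F"
proof -
  have "\<exists>x. d2 S x y = q" for y q
  proof -
    obtain \<epsilon> where \<epsilon>: "0 < \<epsilon>" "\<And>x x' y. x \<le> x' \<Longrightarrow> \<epsilon> * (x' - x) \<le> d2 S x y - d2 S x' y"
      using generating_function_twist[OF generating] by blast
    define M where "M = \<bar>q - d2 S 0 y\<bar> / \<epsilon>"
    have M: "0 \<le> M" "\<epsilon> * M = \<bar>q - d2 S 0 y\<bar>" using \<epsilon>(1) by (auto simp: M_def)
    have "continuous_on {- M..M} (\<lambda>x. d2 S x y)"
      by (intro continuous_at_imp_continuous_on ballI DERIV_isCont[OF C2_map_partials(4)[OF C2_S]])
    moreover have "d2 S M y \<le> q" "q \<le> d2 S (- M) y"
      using \<epsilon>(2)[of 0 M y] \<epsilon>(2)[of "- M" 0 y] M by auto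
    ultimately show ?thesis using IVT2'[of "\<lambda>x. d2 S x y" M q "- M"] M(1) by auto
  qed
  then have "\<exists>x. F (x, - d1 S x y) = (y, q)" for y q by (metis F_generated)
  then show ?thesis unfolding surj_def by (metis prod.collapse)
qed

text \<open>A continuous injection of the plane is open, by invariance of domain.\<close>

lemma F_inverse_continuous: "continuous_on UNIV (inv F)"
proof -
  obtain g where g: "homeomorphism UNIV (range F) F g"
    using invariance_of_domain_homeomorphism[OF open_UNIV F_continuous _ F_injective] by auto
  then have "inv F = g"
    using F_surjective by (auto simp: homeomorphism_def fun_eq_iff intro: inv_f_eq[OF F_injective])
  then show ?thesis using g F_surjective by (simp add: homeomorphism_def)
qed

lemma F_translate: "F (x + 1, p) = (fst (F (x, p)) + 1, snd (F (x, p)))"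
proof -
  show ?thesis
    using F_eq_iff[of x p "fst (F (x, p))" "snd (F (x, p))"]
      generating_function_partials_shift[OF generating]
    by (simp add: F_eq_iff)
qed

lemma cost_partials:
  "((\<lambda>t. L t y) has_real_derivative d1 S x y + c) (at x)"
  "((\<lambda>t. L x t) has_real_derivative d2 S x y - c) (at y)"
  unfolding S_coh_def
  by (auto intro!: derivative_eq_intros C2_map_partials(1,2)[OF C2_S])

text \<open>Crossing is expensive: this is the Aubry inequality, obtained from the twist condition by integration
over the interval from \<open>y\<close> to \<open>y'\<close>.\<close>

lemma cost_crossing:
  assumes "x < x'" "y < y'"
  shows "L x' y' - L x' y < L x y' - L x y"
proof -
  have "L x y - L x' y < L x y' - L x' y'"
  proof (rule DERIV_pos_imp_increasing[OF assms(2)])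
    fix t
    have "((\<lambda>t. L x t - L x' t) has_real_derivative (d2 S x t - c) - (d2 S x' t - c)) (at t)"
      by (intro derivative_intros cost_partials)
    then show "\<exists>d. ((\<lambda>t. L x t - L x' t) has_real_derivative d) (at t) \<and> 0 < d"
      using d2_strict_antimono[OF assms(1), of t] by (intro exI conjI) auto
  qed
  then show ?thesis by simp
qed

lemma T_minus_eq: "T_minus S c u x = lax_oleinik u x"
  by (simp add: T_minus_def lax_oleinik_def)

lemma S_bar_eqI:
  assumes "weak_solution s u"
  shows "S_bar S c = s"
  unfolding S_bar_def T_minus_eq
proof (rule the_equality)
  show "\<exists>u. continuous_on UNIV u \<and> periodic1 u \<and> (\<forall>x. u x = lax_oleinik u x - s)"
    using assms by (auto simp: weak_solution_def)
  fix s' assume "\<exists>u. continuous_on UNIV u \<and> periodic1 u \<and> (\<forall>x. u x = lax_oleinik u x - s')"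
  then obtain u' where "weak_solution s' u'" by (auto simp: weak_solution_def)
  then show "s' = s" using assms weak_solution_constant_le by (meson antisym)
qed

lemma weak_KAM_iff: "weak_KAM S c u \<longleftrightarrow> weak_solution (S_bar S c) u"
  by (simp add: weak_KAM_def weak_solution_def T_minus_eq)

lemma sub_action_iff: "sub_action S c v \<longleftrightarrow> is_sub_action (S_bar S c) v"
  by (simp add: sub_action_def is_sub_action_def)

lemma weak_KAM_exists: obtains u where "weak_KAM S c u"
  using weak_solution_exists S_bar_eqI that unfolding weak_KAM_iff by metis

section \<open>Calibrated pairs, the graph of the derivative and the map Lambda\<close>

text \<open>A calibrated source \<open>w\<close> provides a smooth function that touches \<open>v\<close> from above at \<open>x\<close>, and a calibrated
target \<open>y\<close> one that touches it from below; hence \<open>v\<close> is differentiable at \<open>x\<close> and both have its slope.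
The equality of slopes is the discrete Euler--Lagrange equation, so \<open>F\<close> maps the point over \<open>w\<close>
to the point over \<open>x\<close> and that one to the point over \<open>y\<close>.\<close>

lemma calibrated_on_both_sides:
  assumes v: "is_sub_action s v" and "calibrated s v w x" "calibrated s v x y"
  shows "(v has_real_derivative d2 S w x - c) (at x)" "d2 S w x = - d1 S x y"
proof -
  let ?\<phi> = "\<lambda>t. v y - L t y + s" and ?\<psi> = "\<lambda>t. v w + L w t - s"
  have \<phi>: "(?\<phi> has_real_derivative - (d1 S x y + c)) (at x)"
    by (auto intro!: derivative_eq_intros cost_partials)
  have \<psi>: "(?\<psi> has_real_derivative d2 S w x - c) (at x)"
    by (auto intro!: derivative_eq_intros cost_partials)
  have ineq: "v b - v a \<le> L a b - s" for a b using v by (simp add: is_sub_action_def)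
  have le: "?\<phi> t \<le> v t" "v t \<le> ?\<psi> t" for t using ineq[of y t] ineq[of t w] by auto
  have eq: "?\<phi> x = v x" "v x = ?\<psi> x" using assms(2,3) by (auto simp: calibrated_def)
  have "- (d1 S x y + c) = d2 S w x - c" "(v has_real_derivative - (d1 S x y + c)) (at x)"
    using has_real_derivative_between[of ?\<phi> _ x ?\<psi> _ v, OF \<phi> \<psi> le eq] by auto
  then show "(v has_real_derivative d2 S w x - c) (at x)" "d2 S w x = - d1 S x y" by auto
qed

lemma graph_deriv_iff:
  "(x, q) \<in> graph_deriv c u \<longleftrightarrow> (u has_real_derivative q - c) (at x)"
proof
  assume "(x, q) \<in> graph_deriv c u"
  then have "u differentiable (at x)" "q - c = deriv u x" by (auto simp: graph_deriv_def)
  then show "(u has_real_derivative q - c) (at x)"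
    by (simp add: DERIV_deriv_iff_real_differentiable)
next
  assume "(u has_real_derivative q - c) (at x)"
  then show "(x, q) \<in> graph_deriv c u"
    unfolding graph_deriv_def by (auto simp: real_differentiable_def DERIV_imp_deriv)
qed

text \<open>Where a weak solution is differentiable, its slope determines the optimal source \<open>w\<close>. This point has
an optimal source of its own and therefore lies between two calibrated points, so the solution is
differentiable there too: the graph of the derivative is mapped into itself by the inverse of \<open>F\<close>.\<close>

lemma graph_deriv_source:
  assumes u: "weak_solution s u" and "(x, q) \<in> graph_deriv c u"
  obtains w where "\<bar>w - x\<bar> \<le> R" "calibrated s u w x" "q = d2 S w x"
    "(w, - d1 S w x) \<in> graph_deriv c u"
proof -
  have sub: "is_sub_action s u" using u by (rule weak_solution_imp_sub_action)
  then have ineq: "u b - u a \<le> L a b - s" for a b by (simp add: is_sub_action_def)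
  obtain w where w: "\<bar>w - x\<bar> \<le> R" "calibrated s u w x"
    by (rule weak_solution_calibrated_source[OF u])
  obtain w' where w': "calibrated s u w' w"
    by (rule weak_solution_calibrated_source[OF u])
  have "((\<lambda>t. u w + L w t - s) has_real_derivative d2 S w x - c) (at x)"
    by (auto intro!: derivative_eq_intros cost_partials)
  then have "q - c = d2 S w x - c"
  proof (rule derivatives_agree_if_touching[OF assms(2)[unfolded graph_deriv_iff]])
    show "u t \<le> u w + L w t - s" for t using ineq[of t w] by simp
    show "u x = u w + L w x - s" using w(2) by (simp add: calibrated_def)
  qed
  moreover have "(w, - d1 S w x) \<in> graph_deriv c u"
    unfolding graph_deriv_iff using calibrated_on_both_sides[OF sub w' w(2)] by simp
  ultimately show ?thesis using that w by simp
qed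

lemma graph_deriv_pullback:
  assumes u: "weak_solution s u" and "F z \<in> graph_deriv c u"
  shows "z \<in> graph_deriv c u" "calibrated s u (fst z) (fst (F z))"
proof -
  obtain w where w: "calibrated s u w (fst (F z))" "snd (F z) = d2 S w (fst (F z))"
    "(w, - d1 S w (fst (F z))) \<in> graph_deriv c u"
    by (rule graph_deriv_source[OF u, of "fst (F z)" "snd (F z)"]) (use assms(2) in simp)
  have "F (w, - d1 S w (fst (F z))) = F z"
    using w(2) by (simp add: F_generated prod_eq_iff)
  then have z: "(w, - d1 S w (fst (F z))) = z" by (rule injD[OF F_injective])
  show "z \<in> graph_deriv c u" using w(3) unfolding z .
  have "w = fst z" using arg_cong[OF z, of fst] by simp
  then show "calibrated s u (fst z) (fst (F z))" using w(1) by simp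
qed

text \<open>For a point \<open>y\<close> strictly between two maximizers, the crossing inequality with one of them excludes an
optimal source of \<open>y\<close> on the left of \<open>x\<close>, and with the other one on the right. All these \<open>y\<close> thus have
the same source \<open>x\<close>. But the slope of \<open>u\<close> at \<open>x\<close>, which exists as \<open>x\<close> has a source itself, determines
the target.\<close>

lemma forward_maximizer_unique:
  assumes u: "weak_solution s u"
    and y1: "\<And>z. u z - L x z \<le> u y1 - L x y1" and y2: "\<And>z. u z - L x z \<le> u y2 - L x y2"
  shows "y1 = y2"
proof -
  have sub: "is_sub_action s u" using u by (rule weak_solution_imp_sub_action)
  then have ineq: "u b - u a \<le> L a b - s" for a b by (simp add: is_sub_action_def)
  have no_gap: False if lt: "y1 < y2" and y1: "\<And>z. u z - L x z \<le> u y1 - L x y1"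
    and y2: "\<And>z. u z - L x z \<le> u y2 - L x y2" for y1 y2
  proof -
    have calib: "calibrated s u x y" if "y1 < y" "y < y2" for y
    proof -
      obtain w where w: "calibrated s u w y"
        by (rule weak_solution_calibrated_source[OF u])
      have "\<not> w < x"
        using cost_crossing[of w x y1 y] \<open>y1 < y\<close> y1[of y] ineq[of y1 w] w
        by (auto simp: calibrated_def)
      moreover have "\<not> x < w"
        using cost_crossing[of x w y y2] \<open>y < y2\<close> y2[of y] ineq[of y2 w] w
        by (auto simp: calibrated_def)
      ultimately show ?thesis using w by (metis linorder_neqE_linordered_idom)
    qed
    obtain w where w: "calibrated s u w x"
      by (rule weak_solution_calibrated_source[OF u])
    obtain a where a: "y1 < a" "a < y2" using dense[OF lt] by blast
    obtain b where b: "y1 < b" "b < a" using dense[OF a(1)] by blast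
    have "d1 S x a = d1 S x b"
      using calibrated_on_both_sides(2)[OF sub w calib, of a] calibrated_on_both_sides(2)[OF sub w calib, of b]
        a b by simp
    then show False using d1_injective b(2) by blast
  qed
  show ?thesis
  proof (rule ccontr)
    assume "y1 \<noteq> y2"
    then consider "y1 < y2" | "y2 < y1" by linarith
    then show False
    proof cases
      case 1
      then show ?thesis using y1 y2 by (rule no_gap)
    next
      case 2
      then show ?thesis using y2 y1 by (rule no_gap)
    qed
  qed
qed

lemma Lambda_eq:
  assumes u: "weak_solution s u" and y: "\<And>z. u z - L x z \<le> u y - L x y"
  shows "Lambda S c u (x, p) = (y, d2 S x y)"
proof -
  have T: "T_plus S c u x = u y - L x y"
    unfolding T_plus_def by (rule cSup_eq_maximum) (use y in auto)
  have "(THE y. T_plus S c u x = u y - L x y) = y"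
  proof (rule the_equality)
    fix y' assume "T_plus S c u x = u y' - L x y'"
    then show "y' = y" using T y by (intro forward_maximizer_unique[OF u, of x]) auto
  qed (rule T)
  then show ?thesis by (simp add: Lambda_def)
qed

lemma calibrated_imp_maximizer:
  assumes "is_sub_action s u" "calibrated s u x y"
  shows "u z - L x z \<le> u y - L x y"
proof -
  have "u z - u x \<le> L x z - s" using assms(1) by (simp add: is_sub_action_def)
  then show ?thesis using assms(2) by (simp add: calibrated_def)
qed

text \<open>\<open>Lambda\<close> is a function of the first coordinate, while \<open>F\<close> depends on both; the two maps agree on a point of the graph of the derivative whose image under \<open>F\<close> stays in that graph.\<close>

lemma Lambda_eq_F_if_in_graph:
  assumes u: "weak_solution s u" and z: "F z \<in> graph_deriv c u"
  shows "Lambda S c u z = F z"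
proof -
  obtain x y where xy: "z = (x, - d1 S x y)" "F z = (y, d2 S x y)" by (rule F_cases)
  have "calibrated s u x y" using graph_deriv_pullback(2)[OF u z] xy by simp
  then have "Lambda S c u z = (y, d2 S x y)"
    unfolding xy(1)
    by (intro Lambda_eq[OF u] calibrated_imp_maximizer[OF weak_solution_imp_sub_action[OF u]])
  then show ?thesis using xy(2) by simp
qed

lemma graph_deriv_subset_graph_superdiff: "graph_deriv c u \<subseteq> graph_superdiff c u"
proof
  fix z assume "z \<in> graph_deriv c u"
  then have "(u has_real_derivative snd z - c) (at (fst z))"
    using graph_deriv_iff[of "fst z" "snd z" u] by simp
  then have "snd z - c \<in> superdiff u (fst z)" by (rule superdiff_if_touched_from_above) auto
  then show "z \<in> graph_superdiff c u"
    unfolding graph_superdiff_def by (intro CollectI exI[of _ "fst z"] exI[of _ "snd z - c"]) auto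
qed

lemma Lambda_in_graph_superdiff:
  assumes u: "weak_solution s u"
  shows "Lambda S c u z \<in> graph_superdiff c u"
proof -
  obtain y where y: "\<And>t. u t - L (fst z) t \<le> u y - L (fst z) y"
    using forward_maximizer_exists[of u "fst z"] u unfolding weak_solution_def by metis
  have "((\<lambda>t. u y - L (fst z) y + L (fst z) t) has_real_derivative d2 S (fst z) y - c) (at y)"
    by (auto intro!: derivative_eq_intros cost_partials)
  then have "d2 S (fst z) y - c \<in> superdiff u y"
  proof (rule superdiff_if_touched_from_above)
    show "u t \<le> u y - L (fst z) y + L (fst z) t" for t using y[of t] by simp
  qed simp
  then show ?thesis
    using Lambda_eq[OF u y, of "snd z"] unfolding graph_superdiff_def
    by (auto intro!: exI[of _ "d2 S (fst z) y - c"])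
qed

text \<open>A converse to the previous agreement: if \<open>Lambda\<close> sends \<open>w\<close> to a point over which \<open>u\<close> is differentiable,
the first coordinate of \<open>w\<close> must be the optimal source of that point. There \<open>u\<close> is differentiable as
well, so the superdifferential is a singleton and \<open>w\<close> is the preimage under \<open>F\<close>.\<close>

lemma Lambda_eq_F_if_into_graph:
  assumes u: "weak_solution s u" and w: "w \<in> graph_superdiff c u" and in_graph: "Lambda S c u w \<in> graph_deriv c u"
  shows "F w = Lambda S c u w"
proof -
  obtain x p where p: "w = (x, c + p)" "p \<in> superdiff u x"
    using w unfolding graph_superdiff_def by auto
  obtain y where y: "\<And>t. u t - L x t \<le> u y - L x y"
    using forward_maximizer_exists[of u x] u unfolding weak_solution_def by metis
  have eq: "Lambda S c u w = (y, d2 S x y)"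
    unfolding p(1) by (rule Lambda_eq[OF u y])
  then have "(y, d2 S x y) \<in> graph_deriv c u" using in_graph by simp
  then obtain x' where x': "d2 S x y = d2 S x' y" "(x', - d1 S x' y) \<in> graph_deriv c u"
    by (rule graph_deriv_source[OF u])
  then have "(u has_real_derivative - d1 S x y - c) (at x)"
    using d2_injective graph_deriv_iff by metis
  then have "p = - d1 S x y - c" using p(2) by (rule superdiff_eq_derivative)
  then show ?thesis using F_generated[of x y] p(1) eq by simp
qed

text \<open>Although \<open>Lambda\<close> need not be injective, its preimages of points of the graph of the derivative are
single points: one goes back along orbits of \<open>F\<close>, and these never leave the graph.\<close>

lemma Lambda_preimage_eq:
  assumes u: "weak_solution s u" and z: "z \<in> graph_deriv c u"
  shows "Lambda_preimage S c u m z = {w. (F ^^ m) w = z}"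
proof -
  have "(F ^^ m) w = z" if "w \<in> graph_superdiff c u" "(Lambda S c u ^^ m) w = z" for w
    using that
  proof (induction m arbitrary: w)
    case (Suc m)
    then have Fm: "(F ^^ m) (Lambda S c u w) = z"
      using Lambda_in_graph_superdiff[OF u] by (simp add: funpow_Suc_right del: funpow.simps)
    have "Lambda S c u w \<in> graph_deriv c u"
      using Fm z graph_deriv_pullback(1)[OF u]
    proof (induction m arbitrary: z)
      case (Suc m)
      then show ?case by (metis comp_apply funpow.simps(2))
    qed simp
    then show ?case
      using Lambda_eq_F_if_into_graph[OF u Suc.prems(1)] Fm
      by (simp add: funpow_Suc_right del: funpow.simps)
  qed simp
  moreover have "w \<in> graph_deriv c u \<and> (Lambda S c u ^^ m) w = z" if "(F ^^ m) w = z" for w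
    using that
  proof (induction m arbitrary: w)
    case (Suc m)
    then have "F w \<in> graph_deriv c u" "(Lambda S c u ^^ m) (F w) = z"
      by (simp_all add: funpow_Suc_right del: funpow.simps)
    then show ?case
      using Lambda_eq_F_if_in_graph[OF u, of w] graph_deriv_pullback(1)[OF u, of w]
      by (simp add: funpow_Suc_right del: funpow.simps)
  qed (use z in simp)
  ultimately show ?thesis
    using graph_deriv_subset_graph_superdiff unfolding Lambda_preimage_def by blast
qed

section \<open>The alpha-limit set\<close>

definition pullback_graph :: "(real \<Rightarrow> real) \<Rightarrow> nat \<Rightarrow> (real \<times> real) set" where
  "pullback_graph u n = {w. (F ^^ n) w \<in> graph_deriv c u}"

lemma pullback_graph_0: "pullback_graph u 0 = graph_deriv c u"
  by (simp add: pullback_graph_def)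

lemma pullback_graph_Suc: "w \<in> pullback_graph u (Suc n) \<longleftrightarrow> F w \<in> pullback_graph u n"
  by (simp add: pullback_graph_def funpow_Suc_right del: funpow.simps)

lemma pullback_graph_decreasing:
  assumes "weak_solution s u" "m \<le> n"
  shows "pullback_graph u n \<subseteq> pullback_graph u m"
  using assms(2)
proof (rule lift_Suc_antimono_le[rotated])
  show "pullback_graph u (Suc n) \<subseteq> pullback_graph u n" for n
  proof
    fix w assume "w \<in> pullback_graph u (Suc n)"
    then show "w \<in> pullback_graph u n"
      using graph_deriv_pullback(1)[OF assms(1), of "(F ^^ n) w"] by (simp add: pullback_graph_def)
  qed
qed

text \<open>The union over all \<open>m \<ge> n\<close> reduces to its largest member, as the pulled back graphs decrease.\<close>

lemma alpha_limit_eq: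
  assumes "weak_solution s u"
  shows "alpha_limit S c u = (\<Inter>n. closure (pullback_graph u n))"
proof -
  have "(\<Union>m\<in>{n..}. \<Union>z\<in>graph_deriv c u. Lambda_preimage S c u m z) = (\<Union>m\<in>{n..}. pullback_graph u m)" for n
    using Lambda_preimage_eq[OF assms] by (auto simp: pullback_graph_def)
  moreover have "(\<Union>m\<in>{n..}. pullback_graph u m) = pullback_graph u n" for n
    using pullback_graph_decreasing[OF assms, of n] by auto
  ultimately show ?thesis by (simp add: alpha_limit_def)
qed

lemma F_image_closure_pullback_graph:
  "F ` closure (pullback_graph u (Suc n)) = closure (pullback_graph u n)"
proof
  have "F ` pullback_graph u (Suc n) \<subseteq> pullback_graph u n"
    using pullback_graph_Suc by auto
  then show "F ` closure (pullback_graph u (Suc n)) \<subseteq> closure (pullback_graph u n)"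
    by (intro image_closure_subset continuous_on_subset[OF F_continuous])
       (auto intro: closure_subset[THEN subsetD])
  have F_inv: "F (inv F z) = z" for z by (rule surj_f_inv_f[OF F_surjective])
  have "inv F ` pullback_graph u n \<subseteq> pullback_graph u (Suc n)"
    by (auto simp: pullback_graph_Suc F_inv)
  then have "inv F ` closure (pullback_graph u n) \<subseteq> closure (pullback_graph u (Suc n))"
    by (intro image_closure_subset continuous_on_subset[OF F_inverse_continuous])
       (auto intro: closure_subset[THEN subsetD])
  then show "closure (pullback_graph u n) \<subseteq> F ` closure (pullback_graph u (Suc n))"
    by (metis F_inv image_eqI image_subset_iff subsetI)
qed

text \<open>\<open>F\<close> shifts the decreasing sequence of closed sets by one index, which does not affect its
intersection.\<close>

lemma alpha_limit_invariant:
  assumes u: "weak_solution s u"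
  shows "F ` alpha_limit S c u = alpha_limit S c u"
proof -
  let ?C = "\<lambda>n. closure (pullback_graph u n)"
  have "F ` alpha_limit S c u = (\<Inter>n. F ` ?C n)"
    unfolding alpha_limit_eq[OF u]
    by (rule image_INT[OF F_injective]) auto
  also have "\<dots> = (\<Inter>n. ?C n)"
  proof
    have "(\<Inter>n. F ` ?C n) \<subseteq> F ` ?C (Suc n)" for n by blast
    then show "(\<Inter>n. F ` ?C n) \<subseteq> (\<Inter>n. ?C n)"
      unfolding F_image_closure_pullback_graph by blast
    \<comment> \<open>for \<open>n = 0\<close> the truncated index gives the set of index \<open>0\<close> again, which is contained in its image\<close>
    have "?C (n - 1) \<subseteq> F ` ?C n" for n
    proof (cases n)
      case 0
      have "?C 0 = F ` ?C 1" by (simp add: F_image_closure_pullback_graph)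
      also have "\<dots> \<subseteq> F ` ?C 0"
        by (intro image_mono closure_mono pullback_graph_decreasing[OF u]) simp
      finally show ?thesis using 0 by simp
    qed (simp add: F_image_closure_pullback_graph)
    then show "(\<Inter>n. ?C n) \<subseteq> (\<Inter>n. F ` ?C n)" by blast
  qed
  finally show ?thesis by (simp only: alpha_limit_eq[OF u])
qed

lemma graph_deriv_translate:
  assumes "periodic1 u"
  shows "(x + 1, q) \<in> graph_deriv c u \<longleftrightarrow> (x, q) \<in> graph_deriv c u"
  using assms unfolding graph_deriv_iff DERIV_shift by (simp add: periodic1_def)

lemma pullback_graph_translate:
  assumes "periodic1 u"
  shows "(x + 1, p) \<in> pullback_graph u n \<longleftrightarrow> (x, p) \<in> pullback_graph u n"
proof (induction n arbitrary: x p)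
  case 0
  then show ?case by (simp add: pullback_graph_0 graph_deriv_translate[OF assms])
next
  case (Suc n)
  then show ?case
    using Suc[of "fst (F (x, p))" "snd (F (x, p))"] by (simp add: pullback_graph_Suc F_translate)
qed

lemma graph_deriv_bounded:
  assumes "weak_solution s u"
  obtains B where "\<And>x q. (x, q) \<in> graph_deriv c u \<Longrightarrow> \<bar>q\<bar> \<le> B"
proof -
  obtain B where B: "\<And>x y. \<bar>x - y\<bar> \<le> R \<Longrightarrow> \<bar>d2 S x y\<bar> \<le> B"
    using diagonal_periodic_bounded_on_strip[of "\<lambda>x y. d2 S x y" R,
        OF C2_map_partials(3)[OF C2_S] generating_function_partials_shift(2)[OF generating]] by blast
  have "\<bar>q\<bar> \<le> B" if "(x, q) \<in> graph_deriv c u" for x q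
    using that by (rule graph_deriv_source[OF assms]) (use B in simp)
  then show ?thesis by (rule that)
qed

lemma graph_deriv_nonempty:
  assumes u: "weak_solution s u"
  shows "graph_deriv c u \<noteq> {}"
proof -
  obtain w where w: "calibrated s u w 0" by (rule weak_solution_calibrated_source[OF u])
  obtain w' where "calibrated s u w' w" by (rule weak_solution_calibrated_source[OF u])
  then have "(w, d2 S w' w) \<in> graph_deriv c u"
    using w unfolding graph_deriv_iff
    by (intro calibrated_on_both_sides(1)[OF weak_solution_imp_sub_action[OF u]])
  then show ?thesis by blast
qed

text \<open>Modulo the integer translations the pulled back graphs form a decreasing sequence of nonempty bounded
sets: the graph of the derivative is bounded, since its slopes come from sources at distance at most
\<open>R\<close>. The intersection of the closures over a period is nonempty by compactness.\<close>

lemma alpha_limit_nonempty: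
  assumes u: "weak_solution s u"
  shows "alpha_limit S c u \<noteq> {}"
proof -
  have per: "periodic1 u" using u by (simp add: weak_solution_def)
  obtain B where B: "\<And>x q. (x, q) \<in> graph_deriv c u \<Longrightarrow> \<bar>q\<bar> \<le> B"
    using graph_deriv_bounded[OF u] by blast
  define K where "K n = closure (pullback_graph u n) \<inter> ({0..1} \<times> {- B..B})" for n
  have "K n \<noteq> {}" for n
  proof -
    have "\<exists>z. z \<in> pullback_graph u n"
    proof (induction n)
      case 0
      then show ?case using graph_deriv_nonempty[OF u] by (auto simp: pullback_graph_0)
    next
      case (Suc n)
      then show ?case unfolding pullback_graph_Suc using surjD[OF F_surjective] by metis
    qed
    then obtain x p where xp: "(x, p) \<in> pullback_graph u n" by auto
    obtain k :: int where k: "0 \<le> x + of_int k - 0" "x + of_int k - 0 \<le> 1"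
      by (rule int_translate_near)
    have mem: "(x + of_int k, p) \<in> pullback_graph u n"
      using diagonal_periodic_add_int[of "\<lambda>x y. (x, p) \<in> pullback_graph u n" x k x]
        pullback_graph_translate[OF per] xp by simp
    then have "(x + of_int k, p) \<in> graph_deriv c u"
      using pullback_graph_decreasing[OF u, of 0 n] by (auto simp: pullback_graph_0)
    then have "\<bar>p\<bar> \<le> B" by (rule B)
    then have "(x + of_int k, p) \<in> K n"
      using mem k closure_subset[of "pullback_graph u n"] by (auto simp: K_def abs_le_iff)
    then show ?thesis by blast
  qed
  moreover have "compact (K n)" for n
    unfolding K_def by (intro closed_Int_compact compact_Times) auto
  moreover have "K n \<subseteq> K m" if "m \<le> n" for m n
    unfolding K_def using closure_mono[OF pullback_graph_decreasing[OF u that]] by blast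
  ultimately have "\<Inter>(range K) \<noteq> {}" by (intro compact_nest)
  then show ?thesis by (auto simp: alpha_limit_eq[OF u] K_def)
qed

text \<open>Calibration is a closed condition that holds on the first pulled back graph.\<close>

lemma alpha_limit_calibrated:
  assumes u: "weak_solution s u" and z: "z \<in> alpha_limit S c u"
  shows "calibrated s u (fst z) (fst (F z))"
proof -
  let ?C = "{z. u (fst (F z)) - u (fst z) = L (fst z) (fst (F z)) - s}"
  have ucont: "continuous_on UNIV u" using u unfolding weak_solution_def by blast
  have "continuous_on UNIV (\<lambda>z. L (fst z) (fst (F z)))"
    using continuous_on_compose2[OF cost_continuous, of UNIV "\<lambda>z. (fst z, fst (F z))"] F_continuous
    by (simp add: continuous_intros)
  then have "closed ?C"
    by (intro closed_Collect_eq continuous_intros continuous_on_compose2[OF ucont] F_continuous) auto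
  moreover have "pullback_graph u 1 \<subseteq> ?C"
    using graph_deriv_pullback(2)[OF u] by (auto simp: pullback_graph_def calibrated_def)
  ultimately have "closure (pullback_graph u 1) \<subseteq> ?C" by (intro closure_minimal)
  then show ?thesis using z by (auto simp: alpha_limit_eq[OF u] calibrated_def)
qed

section \<open>The Aubry set\<close>

text \<open>The initial points of the pairs that all sub-actions calibrate simultaneously, lifted by the momentum
that the generating function assigns to the pair. Up to translation by \<open>(0, c)\<close> this turns out to be
the Aubry set; unlike that set it is visibly related to \<open>F\<close>.\<close>

definition universally_calibrated_graph :: "(real \<times> real) set" where
  "universally_calibrated_graph =
     {(x, - d1 S x y) | x y. \<forall>v. sub_action S c v \<longrightarrow> calibrated (S_bar S c) v x y}"

text \<open>Each sub-action has a calibrated target \<open>t\<close> of \<open>y\<close>. All these targets coincide, because the slope at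
\<open>y\<close> is prescribed by the pair \<open>(x, y)\<close> and determines \<open>t\<close>.\<close>

lemma F_universally_calibrated_graph:
  assumes "z \<in> universally_calibrated_graph"
  shows "F z \<in> universally_calibrated_graph"
proof -
  obtain x y where z: "z = (x, - d1 S x y)"
    and univ: "\<And>v. is_sub_action (S_bar S c) v \<Longrightarrow> calibrated (S_bar S c) v x y"
    using assms unfolding universally_calibrated_graph_def sub_action_iff by blast
  obtain u where "weak_KAM S c u" by (rule weak_KAM_exists)
  then have u: "is_sub_action (S_bar S c) u"
    by (simp add: weak_KAM_iff weak_solution_imp_sub_action)
  obtain y' where y': "calibrated (S_bar S c) u y y'"
    using universally_calibrated_target[OF univ u] by blast
  have d: "d2 S x y = - d1 S y y'"
    by (rule calibrated_on_both_sides(2)[OF u univ[OF u] y'])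
  have "calibrated (S_bar S c) v y y'" if v: "is_sub_action (S_bar S c) v" for v
  proof -
    obtain t where t: "calibrated (S_bar S c) v y t"
      using universally_calibrated_target[OF univ v] by blast
    have "d2 S x y = - d1 S y t"
      by (rule calibrated_on_both_sides(2)[OF v univ[OF v] t])
    then have "d1 S y t = d1 S y y'" using d by simp
    then have "t = y'" by (rule d1_injective)
    then show ?thesis using t by simp
  qed
  moreover have "F z = (y, - d1 S y y')" using d by (simp add: z F_generated)
  ultimately show ?thesis
    unfolding universally_calibrated_graph_def sub_action_iff by blast
qed

lemma universally_calibrated_graph_subset_graph_deriv:
  assumes u: "weak_KAM S c u"
  shows "universally_calibrated_graph \<subseteq> graph_deriv c u"
proof
  fix z assume "z \<in> universally_calibrated_graph"
  then obtain x y where z: "z = (x, - d1 S x y)"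
    and univ: "\<And>v. is_sub_action (S_bar S c) v \<Longrightarrow> calibrated (S_bar S c) v x y"
    unfolding universally_calibrated_graph_def sub_action_iff by blast
  have u': "weak_solution (S_bar S c) u" "is_sub_action (S_bar S c) u"
    using u by (auto simp: weak_KAM_iff weak_solution_imp_sub_action)
  obtain w where w: "calibrated (S_bar S c) u w x"
    by (rule weak_solution_calibrated_source[OF u'(1)])
  show "z \<in> graph_deriv c u"
    using calibrated_on_both_sides[OF u'(2) w univ[OF u'(2)]] by (simp add: z graph_deriv_iff)
qed

text \<open>A universally calibrated point has its whole forward orbit in the graph of every weak KAM solution, so
it lies in all the pulled back graphs. Conversely, let \<open>z\<close> be in the \<open>\<alpha>\<close>-limit set of every solution
and let \<open>v\<close> be a sub-action. The forward orbit of \<open>z\<close> is calibrated by the solution \<open>u\<close> to which the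
iterates of \<open>v\<close> converge; hence \<open>u\<close> and \<open>v\<close> agree along the orbit, and \<open>v\<close> calibrates its first step.\<close>

lemma universally_calibrated_graph_eq:
  "universally_calibrated_graph = (\<Inter>u\<in>{u. weak_KAM S c u}. alpha_limit S c u)"
proof (intro equalityI subsetI)
  fix z assume z: "z \<in> universally_calibrated_graph"
  have orbit: "(F ^^ n) z \<in> universally_calibrated_graph" for n
    using z by (induction n) (auto intro: F_universally_calibrated_graph)
  have "z \<in> alpha_limit S c u" if "weak_KAM S c u" for u
  proof -
    have "z \<in> pullback_graph u n" for n
      using orbit universally_calibrated_graph_subset_graph_deriv[OF that]
      by (auto simp: pullback_graph_def)
    then show ?thesis
      using that closure_subset by (fastforce simp: weak_KAM_iff alpha_limit_eq)
  qed
  then show "z \<in> (\<Inter>u\<in>{u. weak_KAM S c u}. alpha_limit S c u)" by blast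
next
  fix z assume z: "z \<in> (\<Inter>u\<in>{u. weak_KAM S c u}. alpha_limit S c u)"
  obtain x y where xy: "z = (x, - d1 S x y)" "F z = (y, d2 S x y)" by (rule F_cases)
  obtain u0 where u0: "weak_solution (S_bar S c) u0"
    using weak_KAM_exists unfolding weak_KAM_iff by blast
  have "calibrated (S_bar S c) v x y" if v: "is_sub_action (S_bar S c) v" for v
  proof -
    obtain u where u: "weak_solution (S_bar S c) u"
      and agree: "\<And>a. (\<And>i. u (a (Suc i)) - u (a i) = L (a i) (a (Suc i)) - S_bar S c) \<Longrightarrow> u (a 0) = v (a 0)"
      using sub_action_below_weak_solution[OF v u0] by metis
    have "(F ^^ n) z \<in> alpha_limit S c u" for n
    proof (induction n)
      case 0
      then show ?case using z u by (simp add: weak_KAM_iff)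
    next
      case (Suc n)
      then show ?case using alpha_limit_invariant[OF u] by auto
    qed
    then have step: "calibrated (S_bar S c) u (fst ((F ^^ n) z)) (fst ((F ^^ Suc n) z))" for n
      using alpha_limit_calibrated[OF u] by simp
    have "u (fst ((F ^^ k) z)) = v (fst ((F ^^ k) z))" for k
      \<comment> \<open>the orbit started at its \<open>k\<close>-th point is calibrated as well\<close>
      using agree[of "\<lambda>i. fst ((F ^^ (i + k)) z)"] step unfolding calibrated_def by simp
    from this[of 0] this[of 1] step[of 0] show ?thesis
      by (simp add: xy(1) F_generated calibrated_def)
  qed
  then show "z \<in> universally_calibrated_graph"
    unfolding universally_calibrated_graph_def sub_action_iff xy(1) by blast
qed

text \<open>The calibrated target gives a smooth function that touches every sub-action from below at \<open>x\<close>; so any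
derivative of a sub-action at \<open>x\<close> is the slope of that function. A weak KAM solution provides a
sub-action that is differentiable there.\<close>

lemma Aubry_set_eq: "Aubry_set S c = (\<lambda>z. z - (0, c)) ` universally_calibrated_graph"
proof (intro equalityI subsetI)
  fix z assume "z \<in> Aubry_set S c"
  then obtain x p y v where z: "z = (x, p)" and v: "is_sub_action (S_bar S c) v"
    and p: "(v has_real_derivative p) (at x)"
    and univ: "\<And>u. is_sub_action (S_bar S c) u \<Longrightarrow> calibrated (S_bar S c) u x y"
    unfolding Aubry_set_def proj_Aubry_set_def sub_action_iff calibrated_def by blast
  have "((\<lambda>t. v y - L t y + S_bar S c) has_real_derivative - (d1 S x y + c)) (at x)"
    by (auto intro!: derivative_eq_intros cost_partials)
  then have "- (d1 S x y + c) = p"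
  proof (rule derivatives_agree_if_touching[OF _ p])
    have ineq: "v y - v t \<le> L t y - S_bar S c" for t using v by (simp add: is_sub_action_def)
    show "v y - L t y + S_bar S c \<le> v t" for t using ineq[of t] by simp
    show "v y - L x y + S_bar S c = v x" using univ[OF v] by (simp add: calibrated_def)
  qed
  then have "z = (x, - d1 S x y) - (0, c)" by (simp add: z)
  then show "z \<in> (\<lambda>z. z - (0, c)) ` universally_calibrated_graph"
    using univ unfolding universally_calibrated_graph_def sub_action_iff by blast
next
  fix z assume "z \<in> (\<lambda>z. z - (0, c)) ` universally_calibrated_graph"
  then obtain x y where z: "z = (x, - d1 S x y) - (0, c)"
    and mem: "(x, - d1 S x y) \<in> universally_calibrated_graph"
    and univ: "\<And>u. sub_action S c u \<Longrightarrow> calibrated (S_bar S c) u x y"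
    unfolding universally_calibrated_graph_def by blast
  obtain u where u: "weak_KAM S c u" by (rule weak_KAM_exists)
  then have "sub_action S c u"
    by (simp add: weak_KAM_iff sub_action_iff weak_solution_imp_sub_action)
  moreover have "(u has_real_derivative - d1 S x y - c) (at x)"
    using universally_calibrated_graph_subset_graph_deriv[OF u] mem graph_deriv_iff by blast
  ultimately show "z \<in> Aubry_set S c"
    using univ unfolding Aubry_set_def proj_Aubry_set_def calibrated_def z by auto
qed

end

theorem theorem1p7:
  fixes f :: "complex \<times> real \<Rightarrow> complex \<times> real"
    and F :: "real \<times> real \<Rightarrow> real \<times> real"
    and S :: "real \<times> real \<Rightarrow> real"
    and c :: real
  assumes "twist_map f"
    and "is_lift F f"
    and "generating_function S F"
  shows "(\<forall>u. weak_KAM S c u \<longrightarrow>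
            closed (alpha_limit S c u) \<and> alpha_limit S c u \<noteq> {} \<and>
            F ` alpha_limit S c u = alpha_limit S c u) \<and>
         Aubry_set S c = (\<lambda>z. z - (0, c)) ` (\<Inter>u\<in>{u. weak_KAM S c u}. alpha_limit S c u)"
proof -
  obtain R where "periodic_cost (\<lambda>x y. S_coh S c (x, y)) R"
    by (rule generating_function_periodic_cost[OF assms(3)])
  then interpret twist_system S c R F
    using assms by (simp add: twist_system_def twist_system_axioms_def is_lift_def)
  show ?thesis
  proof (intro conjI allI impI)
    fix u assume "weak_KAM S c u"
    then have u: "weak_solution (S_bar S c) u" by (simp add: weak_KAM_iff)
    show "closed (alpha_limit S c u)" unfolding alpha_limit_def by (intro closed_INT ballI closed_closure)
    show "alpha_limit S c u \<noteq> {}" by (rule alpha_limit_nonempty[OF u])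
    show "F ` alpha_limit S c u = alpha_limit S c u" by (rule alpha_limit_invariant[OF u])
  next
    show "Aubry_set S c = (\<lambda>z. z - (0, c)) ` (\<Inter>u\<in>{u. weak_KAM S c u}. alpha_limit S c u)"
      by (simp only: Aubry_set_eq universally_calibrated_graph_eq)
  qed
qed

end
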